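(* For all $x,y,z>0$ such that $x\neq y$, $$\lim_{\alpha\to1}\zeta_{\alpha,z}(x,y)=\frac{\ln x-\ln y}{x-y},\qquad\text{where }\ \zeta_{\alpha,z}(x,y):=\frac{z}{\alpha(1-\alpha)}\left(\frac{x^{\frac{1-\alpha}{z}}-y^{\frac{1-\alpha}{z}}}{x-y}\right)\left(\frac{x^{\frac{\alpha}{z}}-y^{\frac{\alpha}{z}}}{x^{\frac1z}-y^{\frac1z}}\right)\ \text{ for }\alpha\in(0,1)\cup(1,\infty).$$ Thus, for every second-order differentiable family $(\rho(\theta))_{\theta\in\mathbb{R}^L}$ of positive definite states on a finite-dimensional Hilbert space and for all $z>0$, $$\lim_{\alpha\to1}I_{\alpha,z}(\theta)=I_{\mathrm{KM}}(\theta).$$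
   Context: For positive definite states (unit-trace operators) $\rho,\sigma$, $\alpha\in(0,1)\cup(1,\infty)$ and $z>0$: $D_{\alpha,z}(\rho\|\sigma):=\frac{1}{\alpha-1}\ln\mathrm{Tr}\big[(\sigma^{\frac{1-\alpha}{2z}}\rho^{\frac\alpha z}\sigma^{\frac{1-\alpha}{2z}})^z\big]$, and $D(\rho\|\sigma):=\mathrm{Tr}[\rho(\ln\rho-\ln\sigma)]$. The $\alpha$-$z$ information matrix has entries $[I_{\alpha,z}(\theta)]_{i,j}:=\frac1\alpha\left.\frac{\partial^2}{\partial\varepsilon_i\partial\varepsilon_j}D_{\alpha,z}(\rho(\theta)\|\rho(\theta+\varepsilon))\right|_{\varepsilon=0}$, and the Kubo--Mori information matrix has entries $[I_{\mathrm{KM}}(\theta)]_{i,j}:=\left.\frac{\partial^2}{\partial\varepsilon_i\partial\varepsilon_j}D(\rho(\theta)\|\rho(\theta+\varepsilon))\right|_{\varepsilon=0}$. *)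

theory Defs
  imports "HOL-Analysis.Analysis"
begin

text \<open>
  Operators on an \<open>n\<close>-dimensional complex Hilbert space are complex matrices
  \<^typ>\<open>complex^'n^'n\<close> with respect to an orthonormal basis.
\<close>

definition cadj :: "complex^'n^'n \<Rightarrow> complex^'n^'n" where
  "cadj A = map_matrix cnj (transpose A)"

definition unitary :: "complex^'n^'n \<Rightarrow> bool" where
  "unitary U \<longleftrightarrow> cadj U ** U = mat 1 \<and> U ** cadj U = mat 1"

definition hermitian :: "complex^'n^'n \<Rightarrow> bool" where
  "hermitian A \<longleftrightarrow> cadj A = A"

definition pos_def :: "complex^'n^'n \<Rightarrow> bool" where
  "pos_def A \<longleftrightarrow> hermitian A \<and> (\<forall>v. v \<noteq> 0 \<longrightarrow> 0 < Re (\<Sum>i\<in>UNIV. cnj (v $ i) * (A *v v) $ i))"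

definition pos_def_state :: "complex^'n^'n \<Rightarrow> bool" where
  "pos_def_state A \<longleftrightarrow> pos_def A \<and> trace A = 1"

definition rdiag :: "('n \<Rightarrow> real) \<Rightarrow> complex^'n^'n" where
  "rdiag d = (\<chi> i j. if i = j then complex_of_real (d i) else 0)"

text \<open>
  Functional calculus of Hermitian matrices: \<open>f(A) = U f(\<Lambda>) U\<^sup>*\<close> for a spectral decomposition
  \<open>A = U \<Lambda> U\<^sup>*\<close>. By \<open>mat_fun_unitary_diag\<close> below the result does not depend on the
  decomposition; for a non-Hermitian \<open>A\<close> the value is unspecified.
\<close>

definition mat_fun :: "(real \<Rightarrow> real) \<Rightarrow> complex^'n^'n \<Rightarrow> complex^'n^'n" where
  "mat_fun f A = (THE B. \<exists>U d. unitary U \<and> A = U ** rdiag d ** cadj U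
                              \<and> B = U ** rdiag (\<lambda>i. f (d i)) ** cadj U)"

lemma rdiag_mult: "(rdiag d ** W) $ i $ j = complex_of_real (d i) * W $ i $ j"
  by (simp add: rdiag_def matrix_matrix_mult_def if_distrib[where f = "\<lambda>x. x * _"] cong: if_cong)

lemma mult_rdiag: "(W ** rdiag d) $ i $ j = W $ i $ j * complex_of_real (d j)"
  by (simp add: rdiag_def matrix_matrix_mult_def if_distrib[where f = "\<lambda>x. _ * x"] cong: if_cong)

lemma unitary_diag_fun_unique:
  assumes U: "unitary U" and V: "unitary V"
    and eq: "U ** rdiag d ** cadj U = V ** rdiag e ** cadj V"
  shows "U ** rdiag (\<lambda>i. f (d i)) ** cadj U = V ** rdiag (\<lambda>i. f (e i)) ** cadj V"
proof -
  define W where "W = cadj V ** U"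
  have UU: "cadj U ** U = mat 1" "U ** cadj U = mat 1"
    and VV: "cadj V ** V = mat 1" "V ** cadj V = mat 1"
    using U V by (auto simp: unitary_def)
  have "W ** rdiag d = cadj V ** (U ** rdiag d ** cadj U) ** U"
    using UU by (simp add: W_def flip: matrix_mul_assoc)
  also have "\<dots> = rdiag e ** W"
    unfolding eq using VV by (simp add: W_def matrix_mul_assoc)
  finally have comm: "W ** rdiag d = rdiag e ** W" .
  have "W $ i $ j * complex_of_real (f (d j)) = complex_of_real (f (e i)) * W $ i $ j" for i j
  proof (cases "W $ i $ j = 0")
    case False
    have "W $ i $ j * complex_of_real (d j) = complex_of_real (e i) * W $ i $ j"
      using arg_cong[OF comm, of "\<lambda>M. M $ i $ j"] by (simp only: rdiag_mult mult_rdiag)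
    then have "d j = e i"
      using False by simp
    then show ?thesis
      by simp
  qed simp
  then have W: "W ** rdiag (\<lambda>i. f (d i)) = rdiag (\<lambda>i. f (e i)) ** W"
    by (simp only: vec_eq_iff rdiag_mult mult_rdiag) simp
  have VW: "V ** W = U"
    using VV by (simp add: W_def matrix_mul_assoc)
  have WU: "W ** cadj U = cadj V"
    using UU by (simp add: W_def flip: matrix_mul_assoc)
  have "U ** rdiag (\<lambda>i. f (d i)) ** cadj U = V ** (W ** rdiag (\<lambda>i. f (d i))) ** cadj U"
    by (simp add: VW matrix_mul_assoc)
  also have "\<dots> = V ** rdiag (\<lambda>i. f (e i)) ** (W ** cadj U)"
    unfolding W by (simp add: matrix_mul_assoc)
  finally show ?thesis
    by (simp add: WU)
qed

lemma mat_fun_unitary_diag: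
  assumes "unitary U"
  shows "mat_fun f (U ** rdiag d ** cadj U) = U ** rdiag (\<lambda>i. f (d i)) ** cadj U"
  unfolding mat_fun_def
proof (rule the_equality)
  show "\<exists>V e. unitary V \<and> U ** rdiag d ** cadj U = V ** rdiag e ** cadj V \<and>
      U ** rdiag (\<lambda>i. f (d i)) ** cadj U = V ** rdiag (\<lambda>i. f (e i)) ** cadj V"
    using assms by blast
qed (use assms unitary_diag_fun_unique in metis)

definition mat_powr :: "complex^'n^'n \<Rightarrow> real \<Rightarrow> complex^'n^'n" where
  "mat_powr A s = mat_fun (\<lambda>t. t powr s) A"

definition mat_ln :: "complex^'n^'n \<Rightarrow> complex^'n^'n" where
  "mat_ln A = mat_fun ln A"

text \<open>The traces in the next two definitions are real for positive definite arguments.\<close>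

definition D_alpha_z :: "real \<Rightarrow> real \<Rightarrow> complex^'n^'n \<Rightarrow> complex^'n^'n \<Rightarrow> real" where
  "D_alpha_z \<alpha> z \<rho> \<sigma> = 1 / (\<alpha> - 1) *
     ln (Re (trace (mat_powr (mat_powr \<sigma> ((1 - \<alpha>) / (2 * z)) ** mat_powr \<rho> (\<alpha> / z)
                              ** mat_powr \<sigma> ((1 - \<alpha>) / (2 * z))) z)))"

definition rel_entropy :: "complex^'n^'n \<Rightarrow> complex^'n^'n \<Rightarrow> real" where
  "rel_entropy \<rho> \<sigma> = Re (trace (\<rho> ** (mat_ln \<rho> - mat_ln \<sigma>)))"

definition partial_deriv :: "'l \<Rightarrow> (real^'l \<Rightarrow> real) \<Rightarrow> real^'l \<Rightarrow> real" where
  "partial_deriv i f x = deriv (\<lambda>t. f (x + t *\<^sub>R axis i 1)) 0"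

definition I_alpha_z :: "real \<Rightarrow> real \<Rightarrow> (real^'l \<Rightarrow> complex^'n^'n) \<Rightarrow> real^'l \<Rightarrow> real^'l^'l" where
  "I_alpha_z \<alpha> z \<rho> \<theta> =
     (\<chi> i j. 1 / \<alpha> * partial_deriv i (partial_deriv j (\<lambda>\<epsilon>. D_alpha_z \<alpha> z (\<rho> \<theta>) (\<rho> (\<theta> + \<epsilon>)))) 0)"

definition I_KM :: "(real^'l \<Rightarrow> complex^'n^'n) \<Rightarrow> real^'l \<Rightarrow> real^'l^'l" where
  "I_KM \<rho> \<theta> =
     (\<chi> i j. partial_deriv i (partial_deriv j (\<lambda>\<epsilon>. rel_entropy (\<rho> \<theta>) (\<rho> (\<theta> + \<epsilon>)))) 0)"

definition twice_differentiable ::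
    "('a::real_normed_vector \<Rightarrow> 'b::real_normed_vector) \<Rightarrow> bool" where
  "twice_differentiable f \<longleftrightarrow>
     (\<exists>f' :: 'a \<Rightarrow> 'a \<Rightarrow>\<^sub>L 'b. (\<forall>x. (f has_derivative blinfun_apply (f' x)) (at x)) \<and>
                           (\<forall>x. f' differentiable (at x)))"

definition zeta_alpha_z :: "real \<Rightarrow> real \<Rightarrow> real \<Rightarrow> real \<Rightarrow> real" where
  "zeta_alpha_z \<alpha> z x y = z / (\<alpha> * (1 - \<alpha>))
     * ((x powr ((1 - \<alpha>) / z) - y powr ((1 - \<alpha>) / z)) / (x - y))
     * ((x powr (\<alpha> / z) - y powr (\<alpha> / z)) / (x powr (1 / z) - y powr (1 / z)))"

end

theory Submission
  imports Defs
begin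

text \<open>
  With the divided difference \<open>dd\<close> of \<open>f\<close>, matrices \<open>A = U diag(d) U\<^sup>*\<close>, \<open>B = V diag(e) V\<^sup>*\<close> satisfy exactly
  \<open>U\<^sup>*(f(B) - f(A))V = dd(d, e) \<circ> U\<^sup>*(B - A)V\<close> with the entrywise product \<open>\<circ>\<close>. Lipschitz continuity of the divided
  difference then makes \<open>f\<close> differentiable at a positive definite \<open>A\<close>, with derivative
  \<open>Df(A)[X] = U (dd(d, d) \<circ> U\<^sup>*XU) U\<^sup>*\<close> depending continuously on \<open>A\<close>.

  Put \<open>s = (1 - \<alpha>)/(2z)\<close>. The first derivative of the trace in \<open>D_alpha_z\<close> is
  \<open>z trace (N \<partial>\<^sub>j B\<^sup>s)\<close> with \<open>N = 2A\<^sup>1\<^sup>-\<^sup>s\<close> at \<open>B = A\<close>. Because \<open>trace (B\<^sup>1\<^sup>-\<^sup>s \<partial>\<^sub>j B\<^sup>s) = s \<partial>\<^sub>j trace B = 0\<close>, one may replace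
  \<open>N\<close> by \<open>N - 2B\<^sup>1\<^sup>-\<^sup>s\<close>, which vanishes at \<open>B = A\<close>; so the second derivative is
  \<open>z trace (\<partial>\<^sub>i(N - 2B\<^sup>1\<^sup>-\<^sup>s) \<partial>\<^sub>j B\<^sup>s)\<close> and involves only first derivatives of matrix functions. As \<open>s \<rightarrow> 0\<close>,
  \<open>\<partial>\<^sub>j B\<^sup>s / s\<close> tends to \<open>\<partial>\<^sub>j ln B\<close>, \<open>\<partial>\<^sub>i N\<close> to \<open>0\<close> and \<open>\<partial>\<^sub>i B\<^sup>1\<^sup>-\<^sup>s\<close> to \<open>\<partial>\<^sub>i B\<close>, which leaves
  \<open>trace (\<partial>\<^sub>i B \<partial>\<^sub>j ln B)\<close>. The same device applied to \<open>trace (B \<partial>\<^sub>j ln B) = 0\<close> evaluates the Kubo--Mori matrix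
  to this expression.
\<close>

section \<open>Complex matrices and the spectral theorem\<close>

lemma cadj_nth [simp]: "cadj A $ i $ j = cnj (A $ j $ i)"
  by (simp add: cadj_def map_matrix_def transpose_def)

lemma cadj_mult: "cadj (A ** B) = cadj B ** cadj A"
  by (simp add: vec_eq_iff matrix_matrix_mult_def mult.commute)

lemma cadj_cadj [simp]: "cadj (cadj A) = A"
  by (simp add: vec_eq_iff)

lemma cadj_diff: "cadj (A - B) = cadj A - cadj B"
  by (simp add: vec_eq_iff)

lemma cadj_rdiag [simp]: "cadj (rdiag d) = rdiag d"
  by (simp add: vec_eq_iff rdiag_def)

lemma rdiag_rdiag: "rdiag d ** rdiag e = rdiag (\<lambda>i. d i * e i)"
  unfolding vec_eq_iff rdiag_mult by (simp add: rdiag_def)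

section \<open>The Frobenius norm: unitary invariance and submultiplicativity\<close>

lemma norm_mat_sq: "(norm (M :: complex^'n^'n))\<^sup>2 = (\<Sum>i\<in>UNIV. \<Sum>j\<in>UNIV. (norm (M $ i $ j))\<^sup>2)"
  by (simp add: norm_vec_def L2_set_def sum_nonneg)

text \<open>The norm of the nested vector type is the Frobenius norm. In its trace form a unitary
  factor cancels, which is the source of unitary invariance.\<close>

lemma norm_mat_sq_trace: "complex_of_real ((norm (M :: complex^'n^'n))\<^sup>2) = trace (cadj M ** M)"
proof -
  have "complex_of_real ((norm M)\<^sup>2) = (\<Sum>j\<in>UNIV. \<Sum>i\<in>UNIV. cnj (M $ j $ i) * M $ j $ i)"
    unfolding norm_mat_sq of_real_sum complex_norm_square
    by (simp only: mult.commute)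
  also have "\<dots> = (\<Sum>i\<in>UNIV. \<Sum>j\<in>UNIV. cnj (M $ j $ i) * M $ j $ i)"
    by (rule sum.swap)
  also have "\<dots> = trace (cadj M ** M)"
    by (simp add: trace_def matrix_matrix_mult_def)
  finally show ?thesis .
qed

lemma unitaryD: "unitary U \<Longrightarrow> cadj U ** U = mat 1" "unitary U \<Longrightarrow> U ** cadj U = mat 1"
  by (auto simp: unitary_def)

lemma unitary_mat_1: "unitary (mat 1 :: complex^'n^'n)"
proof -
  have "cadj (mat 1 :: complex^'n^'n) = mat 1"
    by (simp add: vec_eq_iff mat_def)
  then show ?thesis
    by (simp add: unitary_def)
qed

lemma unitary_cadj: "unitary U \<Longrightarrow> unitary (cadj U)"
  by (auto simp: unitary_def)

lemma unitary_mult: "unitary U \<Longrightarrow> unitary V \<Longrightarrow> unitary (U ** V)"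
proof -
  assume "unitary U" "unitary V"
  then have "cadj V ** (cadj U ** U) ** V = mat 1" "U ** (V ** cadj V) ** cadj U = mat 1"
    by (simp_all add: unitaryD)
  then show ?thesis
    by (simp add: unitary_def cadj_mult matrix_mul_assoc)
qed

lemma norm_unitary_left:
  assumes "unitary U"
  shows "norm (U ** M) = norm (M :: complex^'n^'n)"
proof -
  have "cadj (U ** M) ** (U ** M) = cadj M ** (cadj U ** U) ** M"
    by (simp add: cadj_mult matrix_mul_assoc)
  then have "complex_of_real ((norm (U ** M))\<^sup>2) = complex_of_real ((norm M)\<^sup>2)"
    unfolding norm_mat_sq_trace using unitaryD(1)[OF assms] by simp
  then show ?thesis
    by (simp only: of_real_eq_iff) simp
qed

lemma norm_cadj: "norm (cadj M) = norm (M :: complex^'n^'n)"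
proof -
  have "(norm (cadj M))\<^sup>2 = (norm M)\<^sup>2"
    unfolding norm_mat_sq by (subst sum.swap) simp
  then show ?thesis by simp
qed

lemma norm_unitary_right:
  assumes "unitary U"
  shows "norm (M ** U) = norm (M :: complex^'n^'n)"
  using norm_unitary_left[OF unitary_cadj[OF assms], of "cadj M"] norm_cadj[of "M ** U"]
  by (simp add: cadj_mult norm_cadj)

text \<open>Cauchy-Schwarz in each entry. The assumption is an entrywise bound on \<open>C\<close>,
  so the estimate also covers products whose summands carry extra scalar multipliers, as in
  \<open>dop_lipschitz_right\<close>.\<close>

lemma norm_mat_mult_entries:
  fixes C P Q :: "complex^'n^'n"
  assumes "\<And>k l. norm (C $ k $ l) \<le> (\<Sum>m\<in>UNIV. norm (P $ k $ m) * norm (Q $ m $ l))"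
  shows "norm C \<le> norm P * norm Q"
proof (rule power2_le_imp_le)
  have "(norm C)\<^sup>2 \<le> (\<Sum>k\<in>UNIV. \<Sum>l\<in>UNIV. (\<Sum>m\<in>UNIV. (norm (P $ k $ m))\<^sup>2) * (\<Sum>m\<in>UNIV. (norm (Q $ m $ l))\<^sup>2))"
    unfolding norm_mat_sq
  proof (intro sum_mono)
    fix k l
    have "(norm (C $ k $ l))\<^sup>2 \<le> (\<Sum>m\<in>UNIV. norm (P $ k $ m) * norm (Q $ m $ l))\<^sup>2"
      by (intro power_mono assms) simp
    also have "\<dots> \<le> (\<Sum>m\<in>UNIV. (norm (P $ k $ m))\<^sup>2) * (\<Sum>m\<in>UNIV. (norm (Q $ m $ l))\<^sup>2)"
      by (rule Cauchy_Schwarz_ineq_sum)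
    finally show "(norm (C $ k $ l))\<^sup>2 \<le> \<dots>" .
  qed
  also have "\<dots> = (\<Sum>k\<in>UNIV. \<Sum>m\<in>UNIV. (norm (P $ k $ m))\<^sup>2) * (\<Sum>l\<in>UNIV. \<Sum>m\<in>UNIV. (norm (Q $ m $ l))\<^sup>2)"
    by (simp add: sum_product)
  also have "\<dots> = (norm P * norm Q)\<^sup>2"
    unfolding power_mult_distrib norm_mat_sq by (subst (2) sum.swap) simp
  finally show "(norm C)\<^sup>2 \<le> (norm P * norm Q)\<^sup>2" .
qed simp

lemma scaleR_mat_mult: "(c *\<^sub>R A) ** B = c *\<^sub>R (A ** B)" "A ** (c *\<^sub>R B) = c *\<^sub>R (A ** B)"
  for A B :: "complex^'n^'n"
  by (simp_all add: vec_eq_iff matrix_matrix_mult_def scaleR_sum_right)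

lemma bounded_bilinear_mat_mult: "bounded_bilinear ((**) :: complex^'n^'n \<Rightarrow> complex^'n^'n \<Rightarrow> complex^'n^'n)"
proof
  fix A B C :: "complex^'n^'n" and r :: real
  show "(A + B) ** C = A ** C + B ** C"
    by (simp add: vec_eq_iff matrix_matrix_mult_def sum.distrib algebra_simps)
  show "A ** (B + C) = A ** B + A ** C"
    by (rule matrix_add_ldistrib)
  show "(r *\<^sub>R A) ** B = r *\<^sub>R (A ** B)" "A ** (r *\<^sub>R B) = r *\<^sub>R (A ** B)"
    by (rule scaleR_mat_mult)+
  have "norm (A ** B) \<le> norm A * norm B * 1" for A B :: "complex^'n^'n"
    unfolding mult_1_right
    by (rule norm_mat_mult_entries)
       (auto simp: matrix_matrix_mult_def norm_mult intro!: order.trans[OF norm_sum])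
  then show "\<exists>K. \<forall>(A :: complex^'n^'n) (B :: complex^'n^'n). norm (A ** B) \<le> norm A * norm B * K"
    by (intro exI[of _ 1] allI)
qed

interpretation mat_mult: bounded_bilinear "(**) :: complex^'n^'n \<Rightarrow> complex^'n^'n \<Rightarrow> complex^'n^'n"
  by (rule bounded_bilinear_mat_mult)

lemma bounded_linear_Re_trace: "bounded_linear (\<lambda>M :: complex^'n^'n. Re (trace M))"
  unfolding trace_def Re_sum
  by (intro bounded_linear_sum bounded_linear_compose[OF bounded_linear_Re]
      bounded_linear_compose[OF bounded_linear_vec_nth] bounded_linear_vec_nth)

section \<open>Compactness of the unitary group\<close>

lemma continuous_on_cadj [continuous_intros]:
  "continuous_on S f \<Longrightarrow> continuous_on S (\<lambda>x. cadj (f x))"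
  unfolding cadj_def map_matrix_def transpose_def by (simp add: continuous_intros)

text \<open>Closed as the solution set of continuous equations, bounded because every unitary has
  the norm of the identity.\<close>

lemma compact_unitary: "compact {U :: complex^'n^'n. unitary U}"
proof -
  have "closed {U :: complex^'n^'n. unitary U}"
    unfolding unitary_def
    by (intro closed_Collect_conj closed_Collect_eq continuous_intros mat_mult.continuous_on)
  moreover have "bounded {U :: complex^'n^'n. unitary U}"
    unfolding bounded_iff
    by (intro exI[of _ "norm (mat 1 :: complex^'n^'n)"] ballI)
       (metis matrix_mul_rid mem_Collect_eq norm_unitary_left order_refl)
  ultimately show ?thesis
    by (simp add: compact_eq_bounded_closed)
qed

text \<open>
  A maximiser of \<open>U \<mapsto> Re (trace (C ** U\<^sup>* ** A ** U))\<close> over the compact unitary group, with \<open>C\<close> diagonal with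
  distinct entries, diagonalises \<open>A\<close>: otherwise a small rotation in the plane of a nonzero off-diagonal
  entry would increase the value.
\<close>

definition plane_rot :: "'n \<Rightarrow> 'n \<Rightarrow> complex \<Rightarrow> real \<Rightarrow> real \<Rightarrow> complex^'n^'n" where
  "plane_rot p q w c s = (\<chi> a b.
     if b = p then (if a = p then of_real c else if a = q then of_real s * w else 0)
     else if b = q then (if a = p then - of_real s * cnj w else if a = q then of_real c else 0)
     else if a = b then 1 else 0)"

lemma sum_plane_rot:
  fixes F :: "'n::finite \<Rightarrow> complex"
  assumes "p \<noteq> q"
  shows "(\<Sum>a\<in>UNIV. plane_rot p q w c s $ a $ b * F a) =
    (if b = p then of_real c * F p + of_real s * w * F q
     else if b = q then - of_real s * cnj w * F p + of_real c * F q else F b)"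
proof -
  \<comment> \<open>Column \<open>b\<close> is split into contributions at the single rows
    \<open>p\<close>, \<open>q\<close> and \<open>b\<close>, each of which collapses under the
    sum.\<close>
  have "(\<Sum>a\<in>UNIV. plane_rot p q w c s $ a $ b * F a) = (\<Sum>a\<in>UNIV.
      (if a = p then (if b = p then of_real c else if b = q then - of_real s * cnj w else 0) * F a else 0) +
      (if a = q then (if b = p then of_real s * w else if b = q then of_real c else 0) * F a else 0) +
      (if a = b then (if b = p \<or> b = q then 0 else F a) else 0))"
    using assms by (intro sum.cong) (auto simp: plane_rot_def)
  also have "\<dots> = (if b = p then of_real c * F p + of_real s * w * F q
     else if b = q then - of_real s * cnj w * F p + of_real c * F q else F b)"
    using assms by (simp add: sum.distrib)
  finally show ?thesis .
qed

lemma sum_cnj_plane_rot: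
  fixes F :: "'n::finite \<Rightarrow> complex"
  assumes "p \<noteq> q"
  shows "(\<Sum>a\<in>UNIV. cnj (plane_rot p q w c s $ a $ b) * F a) =
    (if b = p then of_real c * F p + of_real s * cnj w * F q
     else if b = q then - of_real s * w * F p + of_real c * F q else F b)"
  using arg_cong[OF sum_plane_rot[OF assms, of w c s b "\<lambda>a. cnj (F a)"], of cnj]
  by (simp split: if_splits)

lemma unitary_plane_rot:
  assumes "p \<noteq> q" "norm w = 1" "c\<^sup>2 + s\<^sup>2 = 1"
  shows "unitary (plane_rot p q w c s :: complex^'n^'n)"
proof -
  let ?G = "plane_rot p q w c s :: complex^'n^'n"
  have "w * cnj w = 1"
    using complex_norm_square[of w] assms(2) by simp
  then have w: "w * (cnj w * x) = x" for x
    by (metis mult.assoc mult_1)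
  have sc: "complex_of_real c * of_real c + of_real s * of_real s = 1"
    by (metis assms(3) of_real_1 of_real_add of_real_mult power2_eq_square)
  have "(cadj ?G ** ?G) $ a $ b = (if a = b then 1 else 0)" for a b
  proof -
    have "(cadj ?G ** ?G) $ a $ b = (\<Sum>m\<in>UNIV. cnj (?G $ m $ a) * ?G $ m $ b)"
      by (simp add: matrix_matrix_mult_def)
    also have "\<dots> = (if a = b then 1 else 0)"
      unfolding sum_cnj_plane_rot[OF assms(1)]
      using assms(1) sc by (auto simp: plane_rot_def w algebra_simps)
    finally show ?thesis .
  qed
  then have "cadj ?G ** ?G = mat 1"
    by (simp add: vec_eq_iff mat_def)
  then show ?thesis
    unfolding unitary_def using matrix_left_right_inverse by blast
qed

theorem hermitian_spectral:
  fixes A :: "complex^'n^'n"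
  assumes "hermitian A"
  obtains U d where "unitary U" "A = U ** rdiag d ** cadj U"
proof -
  obtain c0 :: "'n \<Rightarrow> nat" where c0: "inj c0"
    using finite_imp_inj_to_nat_seg[of "UNIV :: 'n set"] by blast
  \<comment> \<open>Pairwise distinct real weights, taken from an injection of the index type into
    the natural numbers.\<close>
  define c where "c i = real (c0 i)" for i
  define \<phi> where "\<phi> U = Re (trace (rdiag c ** (cadj U ** A ** U)))" for U
  have \<phi>: "\<phi> U = (\<Sum>k\<in>UNIV. c k * Re ((cadj U ** A ** U) $ k $ k))" for U
    unfolding \<phi>_def trace_def by (simp only: rdiag_mult Re_sum) simp
  have "continuous_on {U. unitary U} \<phi>"
    unfolding \<phi>_def
    by (intro continuous_intros mat_mult.continuous_on
        bounded_linear.continuous_on[OF bounded_linear_Re_trace])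
  moreover have "{U :: complex^'n^'n. unitary U} \<noteq> {}"
    using unitary_mat_1 by blast
  ultimately obtain U where U: "unitary U" and max: "\<And>V. unitary V \<Longrightarrow> \<phi> V \<le> \<phi> U"
    using continuous_attains_sup[OF compact_unitary, of \<phi>] by blast
  define H where "H = cadj U ** A ** U"
  have H: "cnj (H $ i $ j) = H $ j $ i" for i j
  proof -
    have "cadj H = H"
      using assms by (simp add: H_def hermitian_def cadj_mult matrix_mul_assoc)
    then show ?thesis
      by (metis cadj_nth)
  qed
  have diag: "H $ p $ q = 0" if pq: "p \<noteq> q" for p q
  proof (rule ccontr)
    assume nz: "H $ p $ q \<noteq> 0"
    have cpq: "c p \<noteq> c q"
      using c0 pq by (auto simp: c_def inj_def)
    \<comment> \<open>The phase makes \<open>(c p - c q) * (w * H $ p $ q)\<close> equal to its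
      modulus, so that rotating by a small positive angle increases \<open>\<phi>\<close>.\<close>
    define w where "w = complex_of_real (sgn (c p - c q)) * cnj (sgn (H $ p $ q))"
    have w: "norm w = 1"
    proof -
      have "\<bar>sgn (c p - c q)\<bar> = 1"
        using cpq by (auto simp: sgn_if)
      then show ?thesis
        using nz by (simp only: w_def norm_mult norm_of_real complex_mod_cnj norm_sgn) simp
    qed
    have wH: "(c p - c q) * Re (w * H $ p $ q) = \<bar>c p - c q\<bar> * norm (H $ p $ q)"
    proof -
      have "cnj (sgn (H $ p $ q)) * H $ p $ q = norm (H $ p $ q)"
        using nz complex_norm_square[of "H $ p $ q"]
        by (simp add: sgn_eq power2_eq_square divide_eq_eq mult.commute)
      then have "w * H $ p $ q = complex_of_real (sgn (c p - c q) * norm (H $ p $ q))"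
        by (simp only: w_def mult.assoc of_real_mult)
      then have "Re (w * H $ p $ q) = sgn (c p - c q) * norm (H $ p $ q)"
        by (simp only: Re_complex_of_real)
      then show ?thesis
        by (simp only: abs_sgn mult.assoc)
    qed
    \<comment> \<open>\<open>g t\<close> is the gain of \<open>\<phi>\<close> under the rotation by
      the angle \<open>t\<close>; its slope at \<open>0\<close> is positive.\<close>
    define g where "g t = (c p - c q) *
       (- (sin t)\<^sup>2 * (Re (H $ p $ p) - Re (H $ q $ q)) + 2 * cos t * sin t * Re (w * H $ p $ q))" for t
    have "(g has_real_derivative 2 * ((c p - c q) * Re (w * H $ p $ q))) (at 0)"
      unfolding g_def by (auto intro!: derivative_eq_intros)
    moreover have "2 * ((c p - c q) * Re (w * H $ p $ q)) > 0"
      unfolding wH using nz cpq by simp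
    ultimately obtain e where e: "e > 0" "\<And>h. h > 0 \<Longrightarrow> h < e \<Longrightarrow> g 0 < g (0 + h)"
      using DERIV_pos_inc_right by blast
    then have gpos: "g (e / 2) > 0"
      using e(2)[of "e / 2"] by (simp add: g_def)
    define t where "t = e / 2"
    let ?G = "plane_rot p q w (cos t) (sin t) :: complex^'n^'n"
    have diag_entries: "(cadj (U ** ?G) ** A ** (U ** ?G)) $ k $ k =
        (\<Sum>b\<in>UNIV. ?G $ b $ k * (\<Sum>a\<in>UNIV. cnj (?G $ a $ k) * H $ a $ b))" for k
    proof -
      have "cadj (U ** ?G) ** A ** (U ** ?G) = cadj ?G ** H ** ?G"
        by (simp add: cadj_mult H_def matrix_mul_assoc)
      then show ?thesis
        by (simp add: matrix_matrix_mult_def mult.commute)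
    qed
    have ww: "w * cnj w = 1"
      using complex_norm_square[of w] w by simp
    have Hqp: "H $ q $ p = cnj (H $ p $ q)"
      by (simp add: H)
    have ss: "(cos t)\<^sup>2 = 1 - (sin t)\<^sup>2"
      by (simp add: cos_squared_eq)
    have Re_comb: "Re (of_real a * K + of_real b * (1 * L) + of_real d * (M + cnj M)) = a * Re K + b * Re L + 2 * d * Re M"
      "Re (of_real a * K + of_real b * (1 * L) - of_real d * (M + cnj M)) = a * Re K + b * Re L - 2 * d * Re M"
      for a b d K L M
      by simp_all
    have "(cadj (U ** ?G) ** A ** (U ** ?G)) $ p $ p =
       complex_of_real ((cos t)\<^sup>2) * H $ p $ p + complex_of_real ((sin t)\<^sup>2) * (w * cnj w * H $ q $ q)
       + complex_of_real (cos t * sin t) * (w * H $ p $ q + cnj (w * H $ p $ q))"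
      unfolding diag_entries sum_plane_rot[OF pq] sum_cnj_plane_rot[OF pq] Hqp
      by (simp add: algebra_simps power2_eq_square)
    then have p: "Re ((cadj (U ** ?G) ** A ** (U ** ?G)) $ p $ p) = Re (H $ p $ p)
      - (sin t)\<^sup>2 * (Re (H $ p $ p) - Re (H $ q $ q)) + 2 * cos t * sin t * Re (w * H $ p $ q)"
      by (simp only: ww Re_comb ss) (simp add: algebra_simps)
    have "(cadj (U ** ?G) ** A ** (U ** ?G)) $ q $ q =
       complex_of_real ((cos t)\<^sup>2) * H $ q $ q + complex_of_real ((sin t)\<^sup>2) * (w * cnj w * H $ p $ p)
       - complex_of_real (cos t * sin t) * (w * H $ p $ q + cnj (w * H $ p $ q))"
      unfolding diag_entries sum_plane_rot[OF pq] sum_cnj_plane_rot[OF pq] Hqp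
      using pq by (simp add: algebra_simps power2_eq_square)
    then have q: "Re ((cadj (U ** ?G) ** A ** (U ** ?G)) $ q $ q) = Re (H $ q $ q)
      + (sin t)\<^sup>2 * (Re (H $ p $ p) - Re (H $ q $ q)) - 2 * cos t * sin t * Re (w * H $ p $ q)"
      by (simp only: ww Re_comb ss) (simp add: algebra_simps)
    have r: "(cadj (U ** ?G) ** A ** (U ** ?G)) $ k $ k = H $ k $ k" if "k \<noteq> p" "k \<noteq> q" for k
      unfolding diag_entries sum_plane_rot[OF pq] sum_cnj_plane_rot[OF pq] using that by simp
    have split: "(\<Sum>k\<in>UNIV. F k) = F p + F q + (\<Sum>k\<in>UNIV - {p, q}. F k)" for F :: "'n \<Rightarrow> real"
      using pq by (subst sum.subset_diff[of "{p, q}"]) auto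
    have "\<phi> (U ** ?G) = \<phi> U + g t"
    proof -
      have "(\<Sum>k\<in>UNIV - {p, q}. c k * Re ((cadj (U ** ?G) ** A ** (U ** ?G)) $ k $ k)) =
            (\<Sum>k\<in>UNIV - {p, q}. c k * Re (H $ k $ k))"
        using r by (intro sum.cong) auto
      then show ?thesis
        unfolding \<phi> split p q H_def[symmetric] by (simp add: g_def algebra_simps)
    qed
    moreover have "\<phi> (U ** ?G) \<le> \<phi> U"
      by (intro max unitary_mult U unitary_plane_rot pq w sin_cos_squared_add2)
    ultimately show False
      using gpos by (simp add: t_def)
  qed
  have "Im (H $ i $ i) = 0" for i
    using arg_cong[OF H[of i i], of Im] by simp
  then have "H = rdiag (\<lambda>i. Re (H $ i $ i))"
    using diag by (simp add: vec_eq_iff rdiag_def complex_eq_iff)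
  moreover have "A = U ** H ** cadj U"
  proof -
    have "U ** H ** cadj U = (U ** cadj U) ** A ** (U ** cadj U)"
      by (simp add: H_def matrix_mul_assoc)
    then show ?thesis
      using unitaryD[OF U] by simp
  qed
  ultimately show thesis
    using that U by metis
qed

section \<open>Divided differences and double operator integrals\<close>

definition dd :: "(real \<Rightarrow> real) \<Rightarrow> (real \<Rightarrow> real) \<Rightarrow> real \<Rightarrow> real \<Rightarrow> real" where
  "dd f f' x y = (if x = y then f' x else (f y - f x) / (y - x))"

lemma dd_mult: "(y - x) * dd f f' x y = f y - f x"
  by (simp add: dd_def)

lemma dd_sym: "dd f f' x y = dd f f' y x"
  unfolding dd_def by (auto simp: divide_simps) (auto simp: algebra_simps)

text \<open>Regularity is asked on the positive half-line, where the eigenvalues of positive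
  definite matrices lie.\<close>

definition C2_pos :: "(real \<Rightarrow> real) \<Rightarrow> (real \<Rightarrow> real) \<Rightarrow> (real \<Rightarrow> real) \<Rightarrow> bool" where
  "C2_pos f f' f'' \<longleftrightarrow> (\<forall>x>0. (f has_real_derivative f' x) (at x) \<and>
     (f' has_real_derivative f'' x) (at x) \<and> isCont f'' x)"

lemma C2_posD:
  assumes "C2_pos f f' f''" "x > 0"
  shows "(f has_real_derivative f' x) (at x)" "(f' has_real_derivative f'' x) (at x)" "isCont f'' x"
  using assms by (auto simp: C2_pos_def)

text \<open>The Hermite-Genocchi formula. One integral covers distinct and coinciding arguments, so
  bounds on \<open>f'\<close> pass to the divided difference without a separate treatment of the
  diagonal.\<close>

lemma dd_has_integral:
  assumes f: "C2_pos f f' f''" and x: "x > 0" and y: "y > 0"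
  shows "((\<lambda>t. f' (x + t * (y - x))) has_integral dd f f' x y) {0..1}"
proof (cases "x = y")
  case True
  then show ?thesis
    using has_integral_const_real[of "f' x" 0 1] by (simp add: dd_def)
next
  case False
  have pos: "x + t * (y - x) > 0" if "t \<in> {0..1}" for t
  proof -
    have "x + t * (y - x) = (1 - t) * x + t * y"
      by (simp add: algebra_simps)
    moreover have "(1 - t) * x + t * y > 0"
      using that x y by (cases "t = 0") (auto intro!: add_nonneg_pos)
    ultimately show ?thesis by simp
  qed
  have "((\<lambda>t. f' (x + t * (y - x))) has_integral
      f (x + 1 * (y - x)) / (y - x) - f (x + 0 * (y - x)) / (y - x)) {0..1}"
  proof (rule fundamental_theorem_of_calculus)
    fix t :: real assume t: "t \<in> {0..1}"
    have "((\<lambda>t. x + t * (y - x)) has_real_derivative y - x) (at t)"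
      by (auto intro!: derivative_eq_intros)
    from DERIV_cdivide[OF DERIV_chain2[where f = f and g = "\<lambda>t. x + t * (y - x)",
          OF C2_posD(1)[OF f pos[OF t]] this], of "y - x"]
    have "((\<lambda>t. f (x + t * (y - x)) / (y - x)) has_real_derivative f' (x + t * (y - x))) (at t)"
      using False by simp
    then show "((\<lambda>t. f (x + t * (y - x)) / (y - x)) has_vector_derivative f' (x + t * (y - x)))
        (at t within {0..1})"
      using has_field_derivative_at_within has_real_derivative_iff_has_vector_derivative by blast
  qed simp
  then show ?thesis
    using False by (simp add: dd_def diff_divide_distrib)
qed

text \<open>On the compact interval \<open>f''\<close> is bounded by some \<open>K\<close>, so
  \<open>f'\<close> is \<open>K\<close>-Lipschitz. Integrating the difference of two integral
  representations keeps this constant, uniformly in the first argument.\<close>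

lemma dd_lipschitz:
  assumes f: "C2_pos f f' f''" and m: "m > 0"
  obtains K where "K \<ge> 0"
    "\<And>x y y'. x \<in> {m..M} \<Longrightarrow> y \<in> {m..M} \<Longrightarrow> y' \<in> {m..M} \<Longrightarrow>
       \<bar>dd f f' x y - dd f f' x y'\<bar> \<le> K * \<bar>y - y'\<bar>"
proof -
  have "continuous_on {m..M} f''"
    using C2_posD(3)[OF f] m by (auto intro!: continuous_at_imp_continuous_on)
  then have "bounded (f'' ` {m..M})"
    by (intro compact_imp_bounded compact_continuous_image) auto
  then obtain K where K: "K > 0" "\<And>x. x \<in> {m..M} \<Longrightarrow> norm (f'' x) \<le> K"
    unfolding bounded_pos by auto
  have lip: "\<bar>f' u - f' v\<bar> \<le> K * \<bar>u - v\<bar>" if "u \<in> {m..M}" "v \<in> {m..M}" for u v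
    using field_differentiable_bound[of "{m..M}" f' f'' K u v] K that m
      has_field_derivative_at_within[OF C2_posD(2)[OF f]]
    by (auto simp: norm_minus_commute)
  show thesis
  proof (rule that[of K])
    fix x y y' assume xy: "x \<in> {m..M}" "y \<in> {m..M}" "y' \<in> {m..M}"
    have conv: "x + t * (v - x) \<in> {m..M}" if "t \<in> {0..1}" "v \<in> {m..M}" for t v
    proof -
      have "(1 - t) *\<^sub>R x + t *\<^sub>R v \<in> {m..M}"
        using that xy(1) by (intro convexD_alt) auto
      then show ?thesis by (simp add: algebra_simps)
    qed
    have "((\<lambda>t. f' (x + t * (y - x)) - f' (x + t * (y' - x))) has_integral
        dd f f' x y - dd f f' x y') {0..1}"
      using xy m by (intro has_integral_diff dd_has_integral[OF f]) auto
    then have I: "((\<lambda>t. f' (x + t * (y - x)) - f' (x + t * (y' - x))) has_integral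
        dd f f' x y - dd f f' x y') (cbox 0 1)"
      by simp
    have "norm (dd f f' x y - dd f f' x y') \<le> (K * \<bar>y - y'\<bar>) * measure lborel (cbox 0 (1::real))"
    proof (rule has_integral_bound[OF _ I])
      fix t :: real assume "t \<in> cbox 0 1"
      then have t: "t \<in> {0..1}" by simp
      have "norm (f' (x + t * (y - x)) - f' (x + t * (y' - x))) \<le> K * \<bar>(x + t * (y - x)) - (x + t * (y' - x))\<bar>"
        unfolding real_norm_def by (intro lip conv t xy)
      also have "(x + t * (y - x)) - (x + t * (y' - x)) = t * (y - y')"
        by (simp add: algebra_simps)
      also have "K * \<bar>t * (y - y')\<bar> \<le> K * (1 * \<bar>y - y'\<bar>)"
        unfolding abs_mult using K(1) t by (intro mult_left_mono mult_right_mono) auto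
      finally show "norm (f' (x + t * (y - x)) - f' (x + t * (y' - x))) \<le> K * \<bar>y - y'\<bar>"
        by simp
    qed (use K in auto)
    then show "\<bar>dd f f' x y - dd f f' x y'\<bar> \<le> K * \<bar>y - y'\<bar>"
      by simp
  qed (use K in auto)
qed

text \<open>
  \<open>dop f f' U d V e\<close> is the double operator integral of the divided difference of \<open>f\<close> for the spectral
  decompositions \<open>(U, d)\<close> and \<open>(V, e)\<close>.
\<close>

definition dop :: "(real \<Rightarrow> real) \<Rightarrow> (real \<Rightarrow> real) \<Rightarrow> complex^'n^'n \<Rightarrow> ('n \<Rightarrow> real) \<Rightarrow>
    complex^'n^'n \<Rightarrow> ('n \<Rightarrow> real) \<Rightarrow> complex^'n^'n \<Rightarrow> complex^'n^'n" where
  "dop f f' U d V e X =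
     U ** (\<chi> i j. complex_of_real (dd f f' (d i) (e j)) * (cadj U ** X ** V) $ i $ j) ** cadj V"

lemma unitary_cancel:
  assumes "unitary U" "unitary V"
  shows "cadj U ** (U ** X ** cadj V) ** V = X" "U ** (cadj U ** X ** V) ** cadj V = X"
proof -
  have "cadj U ** (U ** X ** cadj V) ** V = (cadj U ** U) ** X ** (cadj V ** V)"
    "U ** (cadj U ** X ** V) ** cadj V = (U ** cadj U) ** X ** (V ** cadj V)"
    by (simp_all add: matrix_mul_assoc)
  then show "cadj U ** (U ** X ** cadj V) ** V = X" "U ** (cadj U ** X ** V) ** cadj V = X"
    using assms by (simp_all add: unitaryD)
qed

lemma unitary_transfer_eqI:
  assumes "unitary U" "unitary V" "cadj U ** X ** V = cadj U ** Y ** V"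
  shows "X = Y"
  using unitary_cancel(2)[OF assms(1,2)] assms(3) by metis

text \<open>Seen in the basis \<open>U\<close> on the left and \<open>V\<close> on the right, the
  two matrices act as the scalars \<open>d i\<close> and \<open>e j\<close> on the overlap matrix
  \<open>cadj U ** V\<close>.\<close>

lemma conj_spectral_diff:
  assumes U: "unitary U" and V: "unitary V"
  shows "(cadj U ** (V ** rdiag e ** cadj V - U ** rdiag d ** cadj U) ** V) $ i $ j =
         complex_of_real (e j - d i) * (cadj U ** V) $ i $ j"
proof -
  have "cadj U ** (V ** rdiag e ** cadj V - U ** rdiag d ** cadj U) ** V =
        (cadj U ** V) ** rdiag e ** (cadj V ** V) - (cadj U ** U) ** rdiag d ** (cadj U ** V)"
    by (simp add: mat_mult.diff_left mat_mult.diff_right matrix_mul_assoc)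
  also have "\<dots> = (cadj U ** V) ** rdiag e - rdiag d ** (cadj U ** V)"
    using U V by (simp add: unitaryD)
  finally show ?thesis
    by (simp only: mult_rdiag rdiag_mult vector_minus_component) (simp add: algebra_simps)
qed

text \<open>Applying \<open>conj_spectral_diff\<close> on both sides reduces the claim to the
  defining relation of the divided difference in each entry. The identity is exact, so the Taylor
  remainder of \<open>mat_fun\<close> can later be read off from it.\<close>

lemma spectral_fun_diff:
  assumes U: "unitary U" and V: "unitary V"
  shows "V ** rdiag (\<lambda>i. f (e i)) ** cadj V - U ** rdiag (\<lambda>i. f (d i)) ** cadj U =
         dop f f' U d V e (V ** rdiag e ** cadj V - U ** rdiag d ** cadj U)"
proof (rule unitary_transfer_eqI[OF U V])
  show "cadj U ** (V ** rdiag (\<lambda>i. f (e i)) ** cadj V - U ** rdiag (\<lambda>i. f (d i)) ** cadj U) ** V =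
    cadj U ** dop f f' U d V e (V ** rdiag e ** cadj V - U ** rdiag d ** cadj U) ** V"
    unfolding dop_def unitary_cancel[OF U V]
    unfolding vec_eq_iff vec_lambda_beta conj_spectral_diff[OF U V]
    by (simp add: mult.assoc[symmetric] of_real_mult[symmetric] mult.commute[of "dd _ _ _ _"] dd_mult
        del: of_real_mult of_real_diff)
qed

text \<open>
  In the bases \<open>U\<close> and \<open>V\<close> the entries are \<open>\<Sum>m. (dd (d k) (e l) - dd (d k) (c m)) (U\<^sup>*XY)\<^sub>k\<^sub>m (Y\<^sup>*V)\<^sub>m\<^sub>l\<close>, and the
  factor \<open>e l - c m\<close> of the Lipschitz bound turns \<open>(Y\<^sup>*V)\<^sub>m\<^sub>l\<close> into an entry of the difference of the two matrices.
\<close>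

lemma dop_lipschitz_right:
  assumes U: "unitary U" and V: "unitary V" and Y: "unitary Y" and K: "K \<ge> 0"
    and lip: "\<And>k l m. \<bar>dd f f' (d k) (e l) - dd f f' (d k) (c m)\<bar> \<le> K * \<bar>e l - c m\<bar>"
  shows "norm (dop f f' U d V e X - dop f f' U d Y c X)
    \<le> K * norm X * norm (V ** rdiag e ** cadj V - Y ** rdiag c ** cadj Y)"
proof -
  let ?P = "cadj U ** X ** Y"
  let ?Q = "K *\<^sub>R (cadj Y ** (V ** rdiag e ** cadj V - Y ** rdiag c ** cadj Y) ** V)"
  define C where "C = cadj U ** (dop f f' U d V e X - dop f f' U d Y c X) ** V"
  have PW: "cadj U ** X ** V = ?P ** (cadj Y ** V)"
  proof -
    have "?P ** (cadj Y ** V) = cadj U ** X ** (Y ** cadj Y) ** V"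
      by (simp add: matrix_mul_assoc)
    then show ?thesis
      using unitaryD[OF Y] by simp
  qed
  have "cadj U ** dop f f' U d Y c X ** V = (cadj U ** dop f f' U d Y c X ** Y) ** (cadj Y ** V)"
  proof -
    have "(cadj U ** dop f f' U d Y c X ** Y) ** (cadj Y ** V) =
      cadj U ** dop f f' U d Y c X ** (Y ** cadj Y) ** V"
      by (simp add: matrix_mul_assoc)
    then show ?thesis
      using unitaryD[OF Y] by simp
  qed
  then have C: "C = (\<chi> i j. complex_of_real (dd f f' (d i) (e j)) * (?P ** (cadj Y ** V)) $ i $ j)
     - (\<chi> i j. complex_of_real (dd f f' (d i) (c j)) * ?P $ i $ j) ** (cadj Y ** V)"
    unfolding C_def mat_mult.diff_left mat_mult.diff_right PW[symmetric]
    by (simp only: dop_def unitary_cancel[OF U V] unitary_cancel[OF U Y])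
  have "norm C \<le> norm ?P * norm ?Q"
  proof (rule norm_mat_mult_entries)
    fix k l
    have "C $ k $ l = (\<Sum>m\<in>UNIV. complex_of_real (dd f f' (d k) (e l) - dd f f' (d k) (c m)) *
        (?P $ k $ m * (cadj Y ** V) $ m $ l))"
      unfolding C matrix_matrix_mult_def[of _ "cadj Y ** V"]
      by (simp add: sum_distrib_left sum_subtractf[symmetric] algebra_simps)
    also have "norm \<dots> \<le> (\<Sum>m\<in>UNIV. (K * \<bar>e l - c m\<bar>) * (norm (?P $ k $ m) * norm ((cadj Y ** V) $ m $ l)))"
      unfolding norm_mult
      by (intro order.trans[OF norm_sum] sum_mono) (auto simp: norm_mult intro!: mult_right_mono lip
         simp del: of_real_diff)
    also have "\<dots> = (\<Sum>m\<in>UNIV. norm (?P $ k $ m) * norm (?Q $ m $ l))"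
      unfolding scaleR_vec_def vec_lambda_beta conj_spectral_diff[OF Y V]
      using K by (simp add: norm_mult mult_ac del: of_real_diff)
    finally show "norm (C $ k $ l) \<le> \<dots>" .
  qed
  moreover have "norm C = norm (dop f f' U d V e X - dop f f' U d Y c X)"
    by (simp add: C_def norm_unitary_left norm_unitary_right unitary_cadj U V)
  moreover have "norm ?P = norm X"
    by (simp add: norm_unitary_left norm_unitary_right unitary_cadj U Y)
  moreover have "norm ?Q = K * norm (V ** rdiag e ** cadj V - Y ** rdiag c ** cadj Y)"
    using K by (simp add: norm_unitary_left norm_unitary_right unitary_cadj V Y)
  ultimately show ?thesis
    by (simp only: mult.assoc mult.left_commute[of "norm X"])
qed

text \<open>By symmetry of the divided difference the adjoint exchanges the two decompositions. A
  Lipschitz bound in the right one thus yields a bound in the left one.\<close>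

lemma cadj_dop: "cadj (dop f f' U d V e X) = dop f f' V e U d (cadj X)"
proof -
  have "cadj (cadj U ** X ** V) = cadj V ** cadj X ** U"
    by (simp add: cadj_mult matrix_mul_assoc)
  then have "cnj ((cadj U ** X ** V) $ j $ i) = (cadj V ** cadj X ** U) $ i $ j" for i j
    by (metis cadj_nth)
  then have "cadj (\<chi> i j. complex_of_real (dd f f' (d i) (e j)) * (cadj U ** X ** V) $ i $ j) =
        (\<chi> i j. complex_of_real (dd f f' (e i) (d j)) * (cadj V ** cadj X ** U) $ i $ j)"
    by (simp add: vec_eq_iff dd_sym[of f f' "e _"])
  then show ?thesis
    by (simp add: dop_def cadj_mult matrix_mul_assoc)
qed

text \<open>The decompositions are replaced one at a time, through the mixed operator with
  \<open>(V, e)\<close> on the left and \<open>(U, d)\<close> on the right; the two moves account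
  for the factor \<open>2\<close>.\<close>

lemma dop_lipschitz_both:
  assumes U: "unitary U" and V: "unitary V" and K: "K \<ge> 0"
    and lip: "\<And>x y y'. x \<in> S \<Longrightarrow> y \<in> S \<Longrightarrow> y' \<in> S \<Longrightarrow> \<bar>dd f f' x y - dd f f' x y'\<bar> \<le> K * \<bar>y - y'\<bar>"
    and S: "range d \<subseteq> S" "range e \<subseteq> S"
  shows "norm (dop f f' V e V e X - dop f f' U d U d X)
    \<le> 2 * K * norm X * norm (V ** rdiag e ** cadj V - U ** rdiag d ** cadj U)"
proof -
  let ?D = "V ** rdiag e ** cadj V - U ** rdiag d ** cadj U"
  have 1: "norm (dop f f' V e V e X - dop f f' V e U d X) \<le> K * norm X * norm ?D"
    using S by (intro dop_lipschitz_right U V K lip) auto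
  have "norm (dop f f' U d V e (cadj X) - dop f f' U d U d (cadj X)) \<le> K * norm (cadj X) * norm ?D"
    using S by (intro dop_lipschitz_right U V K lip) auto
  then have 2: "norm (dop f f' V e U d X - dop f f' U d U d X) \<le> K * norm X * norm ?D"
    using norm_cadj[of "dop f f' V e U d X - dop f f' U d U d X"]
    by (simp add: cadj_diff cadj_dop norm_cadj)
  show ?thesis
    using norm_triangle_ineq[of "dop f f' V e V e X - dop f f' V e U d X"
        "dop f f' V e U d X - dop f f' U d U d X"] 1 2
    by (simp add: mult_ac)
qed

text \<open>Column \<open>l\<close> of \<open>cadj U ** V\<close> is a unit vector, and passing to
  the difference of the two matrices multiplies its entries by \<open>e l - d k\<close>. Hence the
  smallest distance is at most the norm of one column, and so at most the Frobenius norm.\<close>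

lemma eigenvalue_close:
  fixes U V :: "complex^'n^'n"
  assumes U: "unitary U" and V: "unitary V"
  shows "\<exists>k. \<bar>e l - d k\<bar> \<le> norm (V ** rdiag e ** cadj V - U ** rdiag d ** cadj U)"
proof -
  let ?D = "V ** rdiag e ** cadj V - U ** rdiag d ** cadj U"
  let ?W = "cadj U ** V"
  have fin: "finite (range (\<lambda>k. \<bar>e l - d k\<bar>))"
    by simp
  obtain k0 where "Min (range (\<lambda>k. \<bar>e l - d k\<bar>)) = \<bar>e l - d k0\<bar>"
    using Min_in[OF fin] unfolding image_iff by blast
  then have k0: "\<bar>e l - d k0\<bar> \<le> \<bar>e l - d k\<bar>" for k
    using Min_le[OF fin, of "\<bar>e l - d k\<bar>"] by simp
  have "cadj ?W ** ?W = mat 1"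
    by (intro unitaryD unitary_mult unitary_cadj U V)
  then have "(cadj ?W ** ?W) $ l $ l = 1"
    by (simp add: mat_def)
  also have "(cadj ?W ** ?W) $ l $ l = (\<Sum>k\<in>UNIV. ?W $ k $ l * cnj (?W $ k $ l))"
    unfolding matrix_matrix_mult_def[of "cadj ?W" ?W] vec_lambda_beta cadj_nth
    by (intro sum.cong refl mult.commute)
  finally have "complex_of_real (\<Sum>k\<in>UNIV. (norm (?W $ k $ l))\<^sup>2) = 1"
    unfolding of_real_sum complex_norm_square .
  then have W1: "(\<Sum>k\<in>UNIV. (norm (?W $ k $ l))\<^sup>2) = 1"
    by (simp only: of_real_eq_1_iff)
  have "\<bar>e l - d k0\<bar>\<^sup>2 = (\<Sum>k\<in>UNIV. \<bar>e l - d k0\<bar>\<^sup>2 * (norm (?W $ k $ l))\<^sup>2)"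
    by (simp only: sum_distrib_left[symmetric] W1 mult_1_right)
  also have "\<dots> \<le> (\<Sum>k\<in>UNIV. \<bar>e l - d k\<bar>\<^sup>2 * (norm (?W $ k $ l))\<^sup>2)"
    by (intro sum_mono mult_right_mono power_mono k0) auto
  also have "\<dots> = (\<Sum>k\<in>UNIV. (norm ((cadj U ** ?D ** V) $ k $ l))\<^sup>2)"
    unfolding conj_spectral_diff[OF U V] norm_mult norm_of_real power_mult_distrib ..
  also have "\<dots> \<le> (\<Sum>k\<in>UNIV. \<Sum>j\<in>UNIV. (norm ((cadj U ** ?D ** V) $ k $ j))\<^sup>2)"
    by (intro sum_mono member_le_sum) auto
  also have "\<dots> = (norm ?D)\<^sup>2"
    unfolding norm_mat_sq[symmetric] by (simp add: norm_unitary_left norm_unitary_right unitary_cadj U V)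
  finally have "\<bar>e l - d k0\<bar> \<le> norm ?D"
    by (rule power2_le_imp_le) simp
  then show ?thesis by blast
qed

section \<open>Differentiating the functional calculus\<close>

text \<open>A fixed choice of eigenbasis, so that the derivative can be written in terms of the
  matrix alone. The choice need not be continuous; the estimates below therefore involve the norm of
  the difference of the matrices and never of the bases.\<close>

definition spec_basis :: "complex^'n^'n \<Rightarrow> complex^'n^'n" where
  "spec_basis A = (SOME U. \<exists>d. unitary U \<and> A = U ** rdiag d ** cadj U)"

definition spec_vals :: "complex^'n^'n \<Rightarrow> 'n \<Rightarrow> real" where
  "spec_vals A = (SOME d. A = spec_basis A ** rdiag d ** cadj (spec_basis A))"

lemma spec:
  assumes "hermitian A"
  shows "unitary (spec_basis A)" "spec_basis A ** rdiag (spec_vals A) ** cadj (spec_basis A) = A"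
proof -
  have "\<exists>U d. unitary U \<and> A = U ** rdiag d ** cadj U"
    using hermitian_spectral[OF assms] by metis
  then have ex: "\<exists>d. unitary (spec_basis A) \<and> A = spec_basis A ** rdiag d ** cadj (spec_basis A)"
    unfolding spec_basis_def by (rule someI_ex)
  then show "unitary (spec_basis A)" by blast
  have "\<exists>d. A = spec_basis A ** rdiag d ** cadj (spec_basis A)"
    using ex by blast
  then have "A = spec_basis A ** rdiag (spec_vals A) ** cadj (spec_basis A)"
    unfolding spec_vals_def by (rule someI_ex)
  then show "spec_basis A ** rdiag (spec_vals A) ** cadj (spec_basis A) = A"
    by (rule sym)
qed

lemma mat_fun_spec:
  assumes "hermitian A"
  shows "mat_fun f A = spec_basis A ** rdiag (\<lambda>i. f (spec_vals A i)) ** cadj (spec_basis A)"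
  using mat_fun_unitary_diag[OF spec(1)[OF assms], of f "spec_vals A"] spec(2)[OF assms] by simp

lemma hermitian_unitary_rdiag: "hermitian (U ** rdiag d ** cadj U)"
  by (simp add: hermitian_def cadj_mult matrix_mul_assoc)

lemma mat_fun_ident: "hermitian A \<Longrightarrow> mat_fun (\<lambda>x. x) A = A"
  by (simp add: mat_fun_spec spec)

lemma mat_fun_mat_fun:
  assumes "hermitian A"
  shows "mat_fun f (mat_fun g A) = mat_fun (\<lambda>x. f (g x)) A"
  by (simp add: mat_fun_spec[OF assms] mat_fun_unitary_diag spec assms)

lemma mat_fun_mult:
  assumes "hermitian A"
  shows "mat_fun f A ** mat_fun g A = mat_fun (\<lambda>x. f x * g x) A"
proof -
  let ?U = "spec_basis A"
  have "mat_fun f A ** mat_fun g A =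
    ?U ** rdiag (\<lambda>i. f (spec_vals A i)) ** (cadj ?U ** ?U) ** rdiag (\<lambda>i. g (spec_vals A i)) ** cadj ?U"
    by (simp add: mat_fun_spec[OF assms] matrix_mul_assoc)
  also have "\<dots> = ?U ** (rdiag (\<lambda>i. f (spec_vals A i)) ** rdiag (\<lambda>i. g (spec_vals A i))) ** cadj ?U"
    using unitaryD(1)[OF spec(1)[OF assms]] by (simp add: matrix_mul_assoc)
  also have "\<dots> = mat_fun (\<lambda>x. f x * g x) A"
    by (simp add: rdiag_rdiag mat_fun_spec[OF assms])
  finally show ?thesis .
qed

lemma mat_fun_const:
  assumes "hermitian A"
  shows "mat_fun (\<lambda>x. c) A = c *\<^sub>R mat 1"
proof -
  have "rdiag (\<lambda>i::'a. c) = c *\<^sub>R mat 1"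
    by (simp add: vec_eq_iff rdiag_def mat_def of_real_def)
  then show ?thesis
    using unitaryD(2)[OF spec(1)[OF assms]]
    by (simp add: mat_fun_spec[OF assms] scaleR_mat_mult)
qed

section \<open>Positive definiteness and the spectrum\<close>

lemma cinner_adj:
  "(\<Sum>i\<in>UNIV. cnj (v $ i) * (A *v w) $ i) = (\<Sum>i\<in>UNIV. cnj ((cadj A *v v) $ i) * w $ i)"
proof -
  have "(\<Sum>i\<in>UNIV. cnj (v $ i) * (A *v w) $ i) = (\<Sum>i\<in>UNIV. \<Sum>j\<in>UNIV. cnj (v $ i) * A $ i $ j * w $ j)"
    by (simp add: matrix_vector_mult_def sum_distrib_left mult.assoc)
  also have "\<dots> = (\<Sum>j\<in>UNIV. \<Sum>i\<in>UNIV. cnj (v $ i) * A $ i $ j * w $ j)"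
    by (rule sum.swap)
  also have "\<dots> = (\<Sum>j\<in>UNIV. cnj ((cadj A *v v) $ j) * w $ j)"
    by (simp add: matrix_vector_mult_def sum_distrib_right mult.commute[of "A $ _ $ _" "cnj _"])
  finally show ?thesis .
qed

lemma qform_conj:
  "(\<Sum>i\<in>UNIV. cnj (v $ i) * ((cadj X ** C ** X) *v v) $ i) =
   (\<Sum>i\<in>UNIV. cnj ((X *v v) $ i) * (C *v (X *v v)) $ i)"
  by (simp add: matrix_vector_mul_assoc[symmetric] matrix_mul_assoc[symmetric] cinner_adj[of v "cadj X"])

lemma qform_rdiag:
  "Re (\<Sum>i\<in>UNIV. cnj (v $ i) * (rdiag d *v v) $ i) = (\<Sum>i\<in>UNIV. d i * (norm (v $ i))\<^sup>2)"
proof -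
  have "(rdiag d *v v) $ i = complex_of_real (d i) * v $ i" for i
    by (simp add: rdiag_def matrix_vector_mult_def if_distrib[where f = "\<lambda>x. x * _"] cong: if_cong)
  then have "(\<Sum>i\<in>UNIV. cnj (v $ i) * (rdiag d *v v) $ i) = (\<Sum>i\<in>UNIV. complex_of_real (d i) * (v $ i * cnj (v $ i)))"
    by (simp add: mult_ac)
  also have "\<dots> = complex_of_real (\<Sum>i\<in>UNIV. d i * (norm (v $ i))\<^sup>2)"
    unfolding of_real_sum of_real_mult complex_norm_square ..
  finally show ?thesis
    by (simp only: Re_complex_of_real)
qed

text \<open>The quadratic form of \<open>cadj X ** C ** X\<close> at \<open>v\<close> is that of
  \<open>C\<close> at \<open>X *v v\<close>, and the left inverse \<open>Y\<close> keeps this vector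
  nonzero.\<close>

lemma pos_def_cong_transform:
  fixes C X Y :: "complex^'n^'n"
  assumes C: "pos_def C" and inv: "Y ** X = mat 1"
  shows "pos_def (cadj X ** C ** X)"
  unfolding pos_def_def
proof (intro conjI allI impI)
  show "hermitian (cadj X ** C ** X)"
    using C by (simp add: pos_def_def hermitian_def cadj_mult matrix_mul_assoc)
  fix v :: "complex^'n" assume "v \<noteq> 0"
  then have "X *v v \<noteq> 0"
    using inv by (metis matrix_vector_mul_assoc matrix_vector_mul_lid matrix_vector_mult_0_right)
  then show "0 < Re (\<Sum>i\<in>UNIV. cnj (v $ i) * ((cadj X ** C ** X) *v v) $ i)"
    unfolding qform_conj using C by (simp add: pos_def_def)
qed

lemma pos_def_rdiag: "pos_def (rdiag d) \<longleftrightarrow> (\<forall>i. 0 < d i)"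
proof
  assume P: "pos_def (rdiag d)"
  show "\<forall>i. 0 < d i"
  proof
    fix i
    have "0 < Re (\<Sum>k\<in>UNIV. cnj (axis i 1 $ k) * (rdiag d *v axis i 1) $ k)"
      using P unfolding pos_def_def by (metis axis_eq_0_iff zero_neq_one)
    then show "0 < d i"
      unfolding qform_rdiag
      by (simp add: axis_def if_distrib[where f = norm] if_distrib[where f = "\<lambda>x. x\<^sup>2"]
          if_distrib[where f = "\<lambda>x. _ * x"] cong: if_cong)
  qed
next
  assume d: "\<forall>i. 0 < d i"
  show "pos_def (rdiag d)"
    unfolding pos_def_def
  proof (intro conjI allI impI)
    fix v :: "complex^'a" assume "v \<noteq> 0"
    then obtain i where "v $ i \<noteq> 0"
      by (auto simp: vec_eq_iff)
    then show "0 < Re (\<Sum>i\<in>UNIV. cnj (v $ i) * (rdiag d *v v) $ i)"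
      unfolding qform_rdiag using d
      by (intro sum_pos2[of _ i]) (auto simp: less_imp_le)
  qed (simp add: hermitian_def)
qed

lemma pos_def_unitary_rdiag:
  assumes U: "unitary U"
  shows "pos_def (U ** rdiag d ** cadj U) \<longleftrightarrow> (\<forall>i. 0 < d i)"
proof
  assume "pos_def (U ** rdiag d ** cadj U)"
  then have "pos_def (cadj U ** (U ** rdiag d ** cadj U) ** U)"
    by (rule pos_def_cong_transform[OF _ unitaryD(1)[OF U]])
  then show "\<forall>i. 0 < d i"
    unfolding unitary_cancel[OF U U] pos_def_rdiag .
next
  assume "\<forall>i. 0 < d i"
  then have "pos_def (cadj (cadj U) ** rdiag d ** cadj U)"
    by (intro pos_def_cong_transform[of _ U]) (simp_all add: pos_def_rdiag unitaryD U)
  then show "pos_def (U ** rdiag d ** cadj U)"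
    by simp
qed

lemma pos_def_hermitian: "pos_def A \<Longrightarrow> hermitian A"
  by (simp add: pos_def_def)

lemma pos_def_spec_vals: "pos_def A \<Longrightarrow> 0 < spec_vals A i"
  using pos_def_unitary_rdiag[OF spec(1), of A "spec_vals A"] spec(2)[of A] pos_def_hermitian[of A]
  by simp

lemma pos_def_mat_fun:
  assumes "pos_def A" "\<And>x. x > 0 \<Longrightarrow> f x > 0"
  shows "pos_def (mat_fun f A)"
  using assms pos_def_spec_vals[OF assms(1)]
  by (simp add: mat_fun_spec pos_def_hermitian pos_def_unitary_rdiag spec)

lemma mat_fun_cong_pos:
  assumes "pos_def A" "\<And>x. x > 0 \<Longrightarrow> f x = g x"
  shows "mat_fun f A = mat_fun g A"
  using assms(2)[OF pos_def_spec_vals[OF assms(1)]]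
  by (simp add: mat_fun_spec pos_def_hermitian assms(1))

lemma trace_conj_unitary:
  assumes "unitary U"
  shows "trace (U ** X ** cadj U) = trace X"
  using trace_mul_sym[of "U ** X" "cadj U"] unitaryD(1)[OF assms]
  by (simp add: matrix_mul_assoc)

lemma trace_mat_fun:
  assumes "hermitian A"
  shows "trace (mat_fun f A) = complex_of_real (\<Sum>i\<in>UNIV. f (spec_vals A i))"
  unfolding mat_fun_spec[OF assms] trace_conj_unitary[OF spec(1)[OF assms]]
  by (simp add: trace_def rdiag_def)

section \<open>The Frechet derivative of the functional calculus\<close>

text \<open>The Daleckii-Krein formula, taken as a definition here and justified by
  \<open>has_derivative_mat_fun\<close>.\<close>

definition mat_fun_deriv :: "(real \<Rightarrow> real) \<Rightarrow> (real \<Rightarrow> real) \<Rightarrow> complex^'n^'n \<Rightarrow> complex^'n^'n \<Rightarrow> complex^'n^'n" where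
  "mat_fun_deriv f f' A = dop f f' (spec_basis A) (spec_vals A) (spec_basis A) (spec_vals A)"

lemma bounded_linear_dop: "bounded_linear (dop f f' (U :: complex^'n^'n) d V e)"
proof -
  have "linear (dop f f' U d V e)"
  proof (rule linearI)
    fix X Y :: "complex^'n^'n" and r :: real
    have "(\<chi> i j. complex_of_real (dd f f' (d i) (e j)) * (cadj U ** (X + Y) ** V) $ i $ j) =
      (\<chi> i j. complex_of_real (dd f f' (d i) (e j)) * (cadj U ** X ** V) $ i $ j) +
      (\<chi> i j. complex_of_real (dd f f' (d i) (e j)) * (cadj U ** Y ** V) $ i $ j)"
      by (simp add: vec_eq_iff mat_mult.add_left mat_mult.add_right algebra_simps)
    then show "dop f f' U d V e (X + Y) = dop f f' U d V e X + dop f f' U d V e Y"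
      by (simp add: dop_def mat_mult.add_left mat_mult.add_right)
    have "(\<chi> i j. complex_of_real (dd f f' (d i) (e j)) * (cadj U ** (r *\<^sub>R X) ** V) $ i $ j) =
      r *\<^sub>R (\<chi> i j. complex_of_real (dd f f' (d i) (e j)) * (cadj U ** X ** V) $ i $ j)"
      by (simp add: vec_eq_iff scaleR_mat_mult)
    then show "dop f f' U d V e (r *\<^sub>R X) = r *\<^sub>R dop f f' U d V e X"
      by (simp add: dop_def scaleR_mat_mult)
  qed
  then show ?thesis
    by (simp add: linear_conv_bounded_linear)
qed

lemma bounded_linear_mat_fun_deriv: "bounded_linear (mat_fun_deriv f f' A)"
  unfolding mat_fun_deriv_def by (rule bounded_linear_dop)

text \<open>Once \<open>eigenvalue_close\<close> confines the spectra of all nearby \<open>B\<close>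
  to one compact interval of positive numbers, both estimates follow from the Lipschitz bounds on
  \<open>dop\<close>. They give differentiability at \<open>A\<close> and continuity of the
  derivative there.\<close>

lemma mat_fun_local:
  assumes f: "C2_pos f f' f''" and A: "pos_def A"
  obtains \<delta> K where "\<delta> > 0" "K \<ge> 0"
    "\<And>B. hermitian B \<Longrightarrow> norm (B - A) < \<delta> \<Longrightarrow>
       norm (mat_fun f B - mat_fun f A - mat_fun_deriv f f' A (B - A)) \<le> K * norm (B - A) * norm (B - A)"
    "\<And>B X. hermitian B \<Longrightarrow> norm (B - A) < \<delta> \<Longrightarrow>
       norm (mat_fun_deriv f f' B X - mat_fun_deriv f f' A X) \<le> K * norm X * norm (B - A)"
proof -
  let ?d = "spec_vals A"
  \<comment> \<open>The spectrum of \<open>A\<close> lies in \<open>[2m, M - m]\<close>. It moves by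
    less than \<open>m\<close> when \<open>norm (B - A) < m\<close>, hence stays in
    \<open>[m, M]\<close>.\<close>
  define m where "m = Min (range ?d) / 2"
  define M where "M = Max (range ?d) + m"
  have "Min (range ?d) > 0"
    using pos_def_spec_vals[OF A] by (subst Min_gr_iff) auto
  then have m: "m > 0"
    by (simp add: m_def)
  have dS: "2 * m \<le> ?d i" "?d i \<le> M - m" for i
    by (auto simp: m_def M_def)
  obtain K where K: "K \<ge> 0"
    "\<And>x y y'. x \<in> {m..M} \<Longrightarrow> y \<in> {m..M} \<Longrightarrow> y' \<in> {m..M} \<Longrightarrow>
       \<bar>dd f f' x y - dd f f' x y'\<bar> \<le> K * \<bar>y - y'\<bar>"
    by (rule dd_lipschitz[OF f m, where M = M]) (rule that; blast)
  note hA = pos_def_hermitian[OF A]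
  note UA = spec(1)[OF hA]
  have SA: "range ?d \<subseteq> {m..M}"
  proof -
    have "m \<le> ?d i" "?d i \<le> M" for i
      using dS[of i] m by linarith+
    then show ?thesis by auto
  qed
  have SB: "range (spec_vals B) \<subseteq> {m..M}" if B: "hermitian B" "norm (B - A) < m" for B
  proof -
    have "spec_vals B l \<in> {m..M}" for l
    proof -
      obtain k where "\<bar>spec_vals B l - ?d k\<bar> \<le> norm (B - A)"
        using eigenvalue_close[OF UA spec(1)[OF B(1)], of "spec_vals B" l ?d]
        unfolding spec(2)[OF hA] spec(2)[OF B(1)] by blast
      then show ?thesis
        using dS[of k] B(2) by (simp only: atLeastAtMost_iff) linarith
    qed
    then show ?thesis by blast
  qed
  show thesis
  proof (rule that[of m "2 * K"])
    fix B assume B: "hermitian B" "norm (B - A) < m"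
    note UB = spec(1)[OF B(1)]
    have "mat_fun f B - mat_fun f A =
        dop f f' (spec_basis A) ?d (spec_basis B) (spec_vals B) (B - A)"
      using spectral_fun_diff[OF UA UB, of f "spec_vals B" ?d f']
      unfolding spec(2)[OF hA] spec(2)[OF B(1)] mat_fun_spec[OF hA] mat_fun_spec[OF B(1)] .
    \<comment> \<open>The increment is the operator with mixed decompositions, the derivative the
      one with \<open>A\<close> on both sides; the remainder is therefore a change of the right
      decomposition.\<close>
    then have "norm (mat_fun f B - mat_fun f A - mat_fun_deriv f f' A (B - A)) \<le> K * norm (B - A) * norm (B - A)"
    proof -
      have "\<bar>dd f f' (?d k) (spec_vals B l) - dd f f' (?d k) (?d n)\<bar> \<le> K * \<bar>spec_vals B l - ?d n\<bar>" for k l n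
        using SA SB[OF B] by (intro K(2)) (simp_all only: image_subset_iff UNIV_I ball_simps)
      from dop_lipschitz_right[where d = ?d and e = "spec_vals B" and c = ?d and X = "B - A",
          OF UA UB UA K(1) this] \<open>mat_fun f B - mat_fun f A = _\<close>
      show ?thesis
        by (simp only: spec(2)[OF hA] spec(2)[OF B(1)] mat_fun_deriv_def)
    qed
    also have "\<dots> \<le> (2 * K) * norm (B - A) * norm (B - A)"
      using K(1) by (intro mult_right_mono) auto
    finally show "norm (mat_fun f B - mat_fun f A - mat_fun_deriv f f' A (B - A)) \<le> \<dots>" .
    fix X
    show "norm (mat_fun_deriv f f' B X - mat_fun_deriv f f' A X) \<le> 2 * K * norm X * norm (B - A)"
      using dop_lipschitz_both[OF UA UB K(1) K(2) SA SB[OF B], of X]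
      by (simp only: spec(2)[OF hA] spec(2)[OF B(1)] mat_fun_deriv_def)
  qed (use m K in auto)
qed

text \<open>The derivative is taken relative to the Hermitian matrices, off which
  \<open>mat_fun\<close> is unspecified.\<close>

lemma has_derivative_mat_fun:
  assumes f: "C2_pos f f' f''" and A: "pos_def A"
  shows "(mat_fun f has_derivative mat_fun_deriv f f' A) (at A within {B. hermitian B})"
proof -
  obtain \<delta> K where \<delta>: "\<delta> > 0" "K \<ge> 0" and bd: "\<And>B. hermitian B \<Longrightarrow> norm (B - A) < \<delta> \<Longrightarrow>
       norm (mat_fun f B - mat_fun f A - mat_fun_deriv f f' A (B - A)) \<le> K * norm (B - A) * norm (B - A)"
    using mat_fun_local[OF f A] by metis
  show ?thesis
    unfolding has_derivative_within_alt
  proof (intro conjI allI impI bounded_linear_mat_fun_deriv)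
    fix e :: real assume e: "e > 0"
    show "\<exists>d>0. \<forall>B\<in>{B. hermitian B}. norm (B - A) < d \<longrightarrow>
        norm (mat_fun f B - mat_fun f A - mat_fun_deriv f f' A (B - A)) \<le> e * norm (B - A)"
    \<comment> \<open>\<open>K + 1\<close> keeps the denominator positive when
      \<open>K = 0\<close>.\<close>
    proof (intro exI[of _ "min \<delta> (e / (K + 1))"] conjI ballI impI)
      fix B assume B: "B \<in> {B. hermitian B}" "norm (B - A) < min \<delta> (e / (K + 1))"
      have "K * norm (B - A) \<le> (K + 1) * norm (B - A)"
        by (intro mult_right_mono) auto
      also have "\<dots> \<le> e"
        using B(2) \<delta>(2) by (simp add: less_divide_eq mult.commute)
      finally have "K * norm (B - A) * norm (B - A) \<le> e * norm (B - A)"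
        by (intro mult_right_mono) auto
      then show "norm (mat_fun f B - mat_fun f A - mat_fun_deriv f f' A (B - A)) \<le> e * norm (B - A)"
        using bd[of B] B by auto
    qed (use \<delta> e in auto)
  qed
qed

lemma has_vector_derivative_mat_fun:
  assumes f: "C2_pos f f' f''" and B: "(B has_vector_derivative B') (at t)"
    and her: "\<And>u. hermitian (B u)" and pos: "pos_def (B t)"
  shows "((\<lambda>u. mat_fun f (B u)) has_vector_derivative mat_fun_deriv f f' (B t) B') (at t)"
proof -
  have "(mat_fun f has_derivative mat_fun_deriv f f' (B t)) (at (B t) within range B)"
    by (rule has_derivative_subset[OF has_derivative_mat_fun[OF f pos]]) (use her in auto)
  then have "((\<lambda>u. mat_fun f (B u)) has_derivative (\<lambda>h. mat_fun_deriv f f' (B t) (h *\<^sub>R B'))) (at t)"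
    using B unfolding has_vector_derivative_def by (rule has_derivative_in_compose[rotated])
  then show ?thesis
    unfolding has_vector_derivative_def
    by (simp add: linear_cmul[OF bounded_linear.linear[OF bounded_linear_mat_fun_deriv]])
qed

text \<open>Base point and direction vary together: the second estimate of
  \<open>mat_fun_local\<close> handles the base point, bounded linearity the direction.\<close>

lemma tendsto_mat_fun_deriv:
  assumes f: "C2_pos f f' f''" and A: "pos_def A"
    and B: "(B \<longlongrightarrow> A) F" and her: "\<And>t. hermitian (B t)" and X: "(X \<longlongrightarrow> X0) F"
  shows "((\<lambda>t. mat_fun_deriv f f' (B t) (X t)) \<longlongrightarrow> mat_fun_deriv f f' A X0) F"
proof -
  obtain \<delta> K where \<delta>: "\<delta> > 0" "K \<ge> 0" and bd: "\<And>B X. hermitian B \<Longrightarrow> norm (B - A) < \<delta> \<Longrightarrow>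
       norm (mat_fun_deriv f f' B X - mat_fun_deriv f f' A X) \<le> K * norm X * norm (B - A)"
    using mat_fun_local[OF f A] by metis
  have 1: "((\<lambda>t. mat_fun_deriv f f' A (X t)) \<longlongrightarrow> mat_fun_deriv f f' A X0) F"
    by (rule bounded_linear.tendsto[OF bounded_linear_mat_fun_deriv X])
  have "((\<lambda>t. K * norm (X t) * norm (B t - A)) \<longlongrightarrow> K * norm X0 * norm (A - A)) F"
    by (intro tendsto_intros X B)
  then have lim: "((\<lambda>t. K * norm (X t) * norm (B t - A)) \<longlongrightarrow> 0) F"
    by simp
  have "\<forall>\<^sub>F t in F. norm (B t - A) < \<delta>"
    using tendstoD[OF B \<delta>(1)] by (simp add: dist_norm)
  then have "\<forall>\<^sub>F t in F. norm (mat_fun_deriv f f' (B t) (X t) - mat_fun_deriv f f' A (X t))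
      \<le> K * norm (X t) * norm (B t - A)"
    by eventually_elim (rule bd[OF her])
  then have "((\<lambda>t. mat_fun_deriv f f' (B t) (X t) - mat_fun_deriv f f' A (X t)) \<longlongrightarrow> 0) F"
    using lim by (rule Lim_null_comparison)
  from tendsto_add[OF this 1] show ?thesis
    by simp
qed

text \<open>\<open>mat_fun g A\<close> is diagonal in the eigenbasis, so the trace meets only the
  diagonal of the divided difference matrix, which consists of values of \<open>f'\<close>.\<close>

lemma trace_mat_fun_deriv:
  assumes "hermitian A"
  shows "trace (mat_fun g A ** mat_fun_deriv f f' A X) = trace (mat_fun (\<lambda>x. g x * f' x) A ** X)"
proof -
  let ?U = "spec_basis A" and ?d = "spec_vals A"
  note U = spec(1)[OF assms]
  have conj_mult: "(?U ** P ** cadj ?U) ** (?U ** Q ** cadj ?U) = ?U ** (P ** Q) ** cadj ?U" for P Q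
  proof -
    have "(?U ** P ** cadj ?U) ** (?U ** Q ** cadj ?U) = ?U ** P ** (cadj ?U ** ?U) ** Q ** cadj ?U"
      by (simp add: matrix_mul_assoc)
    then show ?thesis
      using unitaryD(1)[OF U] by (simp add: matrix_mul_assoc)
  qed
  have "trace (mat_fun g A ** mat_fun_deriv f f' A X) =
    trace (rdiag (\<lambda>i. g (?d i)) ** (\<chi> i j. complex_of_real (dd f f' (?d i) (?d j)) * (cadj ?U ** X ** ?U) $ i $ j))"
    unfolding mat_fun_deriv_def dop_def mat_fun_spec[OF assms] conj_mult trace_conj_unitary[OF U] ..
  also have "\<dots> = trace (rdiag (\<lambda>i. g (?d i) * f' (?d i)) ** (cadj ?U ** X ** ?U))"
    by (simp add: trace_def rdiag_mult dd_def mult.assoc)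
  also have "\<dots> = trace (mat_fun (\<lambda>x. g x * f' x) A ** (?U ** (cadj ?U ** X ** ?U) ** cadj ?U))"
    unfolding mat_fun_spec[OF assms] conj_mult trace_conj_unitary[OF U] ..
  finally show ?thesis
    unfolding unitary_cancel[OF U U] .
qed

text \<open>Used for \<open>x powr (1 - s)\<close> against the derivative of
  \<open>x powr s\<close>, and for the identity against the derivative of \<open>ln\<close>.\<close>

lemma trace_mat_fun_deriv_const:
  assumes "pos_def A" "\<And>x. x > 0 \<Longrightarrow> g x * f' x = c"
  shows "trace (mat_fun g A ** mat_fun_deriv f f' A X) = c *\<^sub>R trace X"
proof -
  have "mat_fun (\<lambda>x. g x * f' x) A = mat_fun (\<lambda>x. c) A"
    using assms by (intro mat_fun_cong_pos) auto
  also have "\<dots> = c *\<^sub>R mat 1"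
    by (rule mat_fun_const[OF pos_def_hermitian[OF assms(1)]])
  finally have "mat_fun (\<lambda>x. g x * f' x) A = c *\<^sub>R mat 1" .
  then show ?thesis
    unfolding trace_mat_fun_deriv[OF pos_def_hermitian[OF assms(1)]]
    by (simp add: scaleR_mat_mult trace_def scaleR_sum_right)
qed

section \<open>Powers and the logarithm\<close>

lemma has_vector_derivative_iff_quotient:
  "(f has_vector_derivative D) (at 0) \<longleftrightarrow> ((\<lambda>t. (f t - f 0) /\<^sub>R t) \<longlongrightarrow> D) (at (0::real))"
proof -
  have "(f has_vector_derivative D) (at 0) \<longleftrightarrow>
      ((\<lambda>t. norm (f t - f 0 - t *\<^sub>R D) / norm t) \<longlongrightarrow> 0) (at 0)"
    by (simp add: has_vector_derivative_def has_derivative_iff_norm bounded_linear_scaleR_left)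
  also have "\<dots> \<longleftrightarrow> ((\<lambda>t. norm ((f t - f 0) /\<^sub>R t - D)) \<longlongrightarrow> 0) (at 0)"
  proof (rule tendsto_cong, rule eventually_at_filter[THEN iffD2], rule always_eventually, intro allI impI)
    fix t :: real assume t: "t \<noteq> 0"
    have "(f t - f 0) /\<^sub>R t - D = (f t - f 0 - t *\<^sub>R D) /\<^sub>R t"
      using t by (simp add: scaleR_diff_right)
    then show "norm (f t - f 0 - t *\<^sub>R D) / norm t = norm ((f t - f 0) /\<^sub>R t - D)"
      by (simp add: divide_inverse mult.commute)
  qed
  also have "\<dots> \<longleftrightarrow> ((\<lambda>t. (f t - f 0) /\<^sub>R t) \<longlongrightarrow> D) (at 0)"
    unfolding tendsto_norm_zero_iff by (rule Lim_null[symmetric])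
  finally show ?thesis .
qed

text \<open>A product rule for a factor \<open>f\<close> vanishing at \<open>0\<close>: the
  difference quotient of the product is that of \<open>f\<close> times \<open>g\<close>, so a limit
  of \<open>g\<close> takes the place of its derivative.\<close>

lemma (in bounded_bilinear) has_vector_derivative_vanishing:
  assumes f: "(f has_vector_derivative f') (at (0::real))" and f0: "f 0 = 0"
    and g: "(g \<longlongrightarrow> g0) (at 0)"
  shows "((\<lambda>t. prod (f t) (g t)) has_vector_derivative prod f' g0) (at 0)"
proof -
  have "((\<lambda>t. (f t - f 0) /\<^sub>R t) \<longlongrightarrow> f') (at 0)"
    using f has_vector_derivative_iff_quotient by blast
  from tendsto[OF this g] show ?thesis
    unfolding has_vector_derivative_iff_quotient by (simp add: f0 zero_left scaleR_left)
qed

lemma C2_pos_powr: "C2_pos (\<lambda>x. x powr s) (\<lambda>x. s * x powr (s - 1)) (\<lambda>x. s * ((s - 1) * x powr (s - 1 - 1)))"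
  unfolding C2_pos_def
proof (intro allI impI conjI)
  fix x :: real assume "0 < x"
  then show "((\<lambda>x. x powr s) has_real_derivative s * x powr (s - 1)) (at x)"
    "((\<lambda>x. s * x powr (s - 1)) has_real_derivative s * ((s - 1) * x powr (s - 1 - 1))) (at x)"
    by (intro DERIV_cmult has_real_derivative_powr; assumption)+
  show "isCont (\<lambda>x. s * ((s - 1) * x powr (s - 1 - 1))) x"
    using \<open>0 < x\<close> by (intro continuous_intros) auto
qed

lemma C2_pos_ln: "C2_pos ln inverse (\<lambda>x. - (inverse x ^ 2))"
  unfolding C2_pos_def
  by (auto intro!: derivative_eq_intros continuous_intros simp: divide_inverse power2_eq_square)

definition powr_deriv :: "real \<Rightarrow> complex^'n^'n \<Rightarrow> complex^'n^'n \<Rightarrow> complex^'n^'n" where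
  "powr_deriv s = mat_fun_deriv (\<lambda>x. x powr s) (\<lambda>x. s * x powr (s - 1))"

definition ln_deriv :: "complex^'n^'n \<Rightarrow> complex^'n^'n \<Rightarrow> complex^'n^'n" where
  "ln_deriv = mat_fun_deriv ln inverse"

lemma bounded_linear_powr_deriv: "bounded_linear (powr_deriv s A)"
  by (simp add: powr_deriv_def bounded_linear_mat_fun_deriv)

lemma mat_powr_mult:
  assumes "hermitian A"
  shows "mat_powr A a ** mat_powr A b = mat_powr A (a + b)"
  by (simp add: mat_powr_def mat_fun_mult[OF assms] powr_add)

lemma mat_powr_powr:
  assumes "hermitian A"
  shows "mat_powr (mat_powr A a) b = mat_powr A (a * b)"
  by (simp add: mat_powr_def mat_fun_mat_fun[OF assms] powr_powr)

lemma mat_powr_one: "pos_def A \<Longrightarrow> mat_powr A 1 = A"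
  using mat_fun_cong_pos[of A "\<lambda>x. x powr 1" "\<lambda>x. x"]
  by (simp add: mat_powr_def mat_fun_ident pos_def_hermitian)

lemma mat_powr_zero:
  assumes "pos_def A"
  shows "mat_powr A 0 = mat 1"
  unfolding mat_powr_def
  using mat_fun_cong_pos[OF assms, of "\<lambda>x. x powr 0" "\<lambda>x. 1"] mat_fun_const[OF pos_def_hermitian[OF assms], of 1]
  by simp

lemma pos_def_mat_powr: "pos_def A \<Longrightarrow> pos_def (mat_powr A s)"
  by (simp add: mat_powr_def pos_def_mat_fun)

lemma trace_mat_powr_pos:
  fixes A :: "complex^'n^'n"
  assumes "pos_def A"
  shows "0 < Re (trace (mat_powr A s))"
proof -
  have "spec_vals A i powr s > 0" for i
    using pos_def_spec_vals[OF assms, of i] by simp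
  then show ?thesis
    unfolding mat_powr_def trace_mat_fun[OF pos_def_hermitian[OF assms]] Re_complex_of_real
    by (intro sum_pos) auto
qed

lemma has_vector_derivative_mat_powr:
  assumes "(B has_vector_derivative B') (at t)" "\<And>u. pos_def (B u)"
  shows "((\<lambda>u. mat_powr (B u) s) has_vector_derivative powr_deriv s (B t) B') (at t)"
  unfolding mat_powr_def powr_deriv_def
  by (intro has_vector_derivative_mat_fun[OF C2_pos_powr assms(1)] pos_def_hermitian assms(2))

lemma trace_powr_deriv:
  assumes "hermitian A"
  shows "trace (powr_deriv s A X) = s *\<^sub>R trace (mat_powr A (s - 1) ** X)"
proof -
  have 1: "mat_fun (\<lambda>x. s * x powr (s - 1)) A = s *\<^sub>R mat_powr A (s - 1)"
    using mat_fun_mult[OF assms, of "\<lambda>_. s" "\<lambda>x. x powr (s - 1)"]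
    by (simp add: mat_fun_const[OF assms] mat_powr_def scaleR_mat_mult)
  have "trace (powr_deriv s A X) = trace (mat_fun (\<lambda>_. 1) A ** powr_deriv s A X)"
    by (simp add: mat_fun_const[OF assms])
  also have "\<dots> = trace (mat_fun (\<lambda>x. s * x powr (s - 1)) A ** X)"
    unfolding powr_deriv_def trace_mat_fun_deriv[OF assms] by simp
  also have "\<dots> = s *\<^sub>R trace (mat_powr A (s - 1) ** X)"
    by (simp add: 1 scaleR_mat_mult trace_def scaleR_sum_right)
  finally show ?thesis .
qed

lemma trace_powr_powr_deriv:
  assumes "pos_def A"
  shows "trace (mat_powr A (1 - s) ** powr_deriv s A X) = s *\<^sub>R trace X"
  unfolding mat_powr_def powr_deriv_def
  by (rule trace_mat_fun_deriv_const[OF assms]) (simp add: powr_add[symmetric])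

lemma trace_ln_deriv:
  assumes "pos_def A"
  shows "trace (A ** ln_deriv A X) = trace X"
proof -
  have "trace (mat_fun (\<lambda>x. x) A ** ln_deriv A X) = 1 *\<^sub>R trace X"
    unfolding ln_deriv_def by (rule trace_mat_fun_deriv_const[OF assms]) simp
  then show ?thesis
    by (simp add: mat_fun_ident pos_def_hermitian[OF assms])
qed

section \<open>Dependence on the exponent\<close>

text \<open>With both decompositions fixed, the parameter enters through the scalar multipliers, so
  convergence of each of them is enough. The factor \<open>c\<close> accommodates a rescaling by
  \<open>1 / s\<close>.\<close>

lemma tendsto_dop:
  assumes "\<And>i j. ((\<lambda>t. c t * dd (f t) (f' t) (d i) (e j)) \<longlongrightarrow> dd g g' (d i) (e j)) F"
  shows "((\<lambda>t. c t *\<^sub>R dop (f t) (f' t) U d V e X) \<longlongrightarrow> dop g g' U d V e X) F"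
proof -
  have "c t *\<^sub>R dop (f t) (f' t) U d V e X =
    U ** (\<chi> i j. complex_of_real (c t * dd (f t) (f' t) (d i) (e j)) * (cadj U ** X ** V) $ i $ j) ** cadj V" for t
  proof -
    have "(\<chi> i j. complex_of_real (c t * dd (f t) (f' t) (d i) (e j)) * (cadj U ** X ** V) $ i $ j) =
      c t *\<^sub>R (\<chi> i j. complex_of_real (dd (f t) (f' t) (d i) (e j)) * (cadj U ** X ** V) $ i $ j)"
      by (simp add: vec_eq_iff scaleR_conv_of_real[where 'a = complex] mult.assoc)
    then show ?thesis
      by (simp add: dop_def scaleR_mat_mult)
  qed
  then show ?thesis
    unfolding dop_def
    by (simp only:) (intro mat_mult.tendsto tendsto_const tendsto_vec_lambda tendsto_mult tendsto_of_real assms)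
qed

lemma tendsto_powr_deriv_param:
  assumes A: "pos_def A"
  shows "((\<lambda>s. powr_deriv s A X) \<longlongrightarrow> powr_deriv s0 A X) (at s0)"
proof -
  have "((\<lambda>s. 1 *\<^sub>R powr_deriv s A X) \<longlongrightarrow> powr_deriv s0 A X) (at s0)"
    unfolding powr_deriv_def mat_fun_deriv_def
  proof (rule tendsto_dop)
    fix i j
    show "((\<lambda>s. 1 * dd (\<lambda>x. x powr s) (\<lambda>x. s * x powr (s - 1)) (spec_vals A i) (spec_vals A j))
        \<longlongrightarrow> dd (\<lambda>x. x powr s0) (\<lambda>x. s0 * x powr (s0 - 1)) (spec_vals A i) (spec_vals A j)) (at s0)"
      using pos_def_spec_vals[OF A, of i] pos_def_spec_vals[OF A, of j]
      unfolding dd_def by (auto intro!: tendsto_eq_intros)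
  qed
  then show ?thesis by simp
qed

lemma powr_quotient_tendsto:
  assumes "(x::real) > 0"
  shows "((\<lambda>s. (x powr s - 1) / s) \<longlongrightarrow> ln x) (at 0)"
proof -
  have "((\<lambda>s. x powr s) has_real_derivative ln x) (at 0)"
    using assms unfolding powr_def by (auto intro!: derivative_eq_intros)
  then show ?thesis
    using assms unfolding has_field_derivative_iff by simp
qed

lemma powr_diff_quotient_tendsto:
  assumes "(x::real) > 0" "y > 0"
  shows "((\<lambda>s. (x powr s - y powr s) / s) \<longlongrightarrow> ln x - ln y) (at 0)"
  using tendsto_diff[OF powr_quotient_tendsto[OF assms(1)] powr_quotient_tendsto[OF assms(2)]]
  by (simp add: diff_divide_distrib[symmetric])

text \<open>Off the diagonal \<open>(y powr s - x powr s) / s\<close> tends to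
  \<open>ln y - ln x\<close>; on it the factor \<open>s\<close> cancels and
  \<open>x powr (s - 1)\<close> tends to \<open>inverse x\<close>.\<close>

lemma tendsto_powr_deriv_ln:
  assumes A: "pos_def A"
  shows "((\<lambda>s. (1 / s) *\<^sub>R powr_deriv s A X) \<longlongrightarrow> ln_deriv A X) (at 0)"
  unfolding powr_deriv_def ln_deriv_def mat_fun_deriv_def
proof (rule tendsto_dop)
  fix i j
  let ?x = "spec_vals A i" and ?y = "spec_vals A j"
  have pos: "?x > 0" "?y > 0"
    using pos_def_spec_vals[OF A] by auto
  show "((\<lambda>s. 1 / s * dd (\<lambda>x. x powr s) (\<lambda>x. s * x powr (s - 1)) ?x ?y) \<longlongrightarrow> dd ln inverse ?x ?y) (at 0)"
  proof (cases "?x = ?y")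
    case True
    have "((\<lambda>s. ?x powr (s - 1)) \<longlongrightarrow> ?x powr (0 - 1)) (at 0)"
      using pos by (intro tendsto_intros) auto
    then have "((\<lambda>s. ?x powr (s - 1)) \<longlongrightarrow> inverse ?x) (at 0)"
      using pos by (simp add: powr_minus)
    moreover have "\<forall>\<^sub>F s in at 0. ?x powr (s - 1) = 1 / s * dd (\<lambda>x. x powr s) (\<lambda>x. s * x powr (s - 1)) ?x ?y"
      using True by (auto simp: eventually_at_filter dd_def)
    ultimately show ?thesis
      using True by (simp add: dd_def[of ln] filterlim_cong)
  next
    case False
    have "((\<lambda>s. (?y powr s - ?x powr s) / s / (?y - ?x)) \<longlongrightarrow> (ln ?y - ln ?x) / (?y - ?x)) (at 0)"
      using False by (intro tendsto_divide powr_diff_quotient_tendsto pos tendsto_const) auto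
    then show ?thesis
      using False by (simp add: dd_def mult.commute)
  qed
qed

lemma tendsto_mat_powr_param:
  assumes A: "pos_def A"
  shows "((\<lambda>s. mat_powr A s) \<longlongrightarrow> mat_powr A s0) (at s0)"
proof -
  have "((\<lambda>s. rdiag (\<lambda>i. spec_vals A i powr s)) \<longlongrightarrow> rdiag (\<lambda>i. spec_vals A i powr s0)) (at s0)"
    unfolding rdiag_def
  proof (intro tendsto_vec_lambda)
    fix i j
    have "((\<lambda>s. complex_of_real (spec_vals A i powr s)) \<longlongrightarrow> complex_of_real (spec_vals A i powr s0)) (at s0)"
      using pos_def_spec_vals[OF A, of i] by (intro tendsto_intros) auto
    then show "((\<lambda>s. if i = j then complex_of_real (spec_vals A i powr s) else 0) \<longlongrightarrow>
        (if i = j then complex_of_real (spec_vals A i powr s0) else 0)) (at s0)"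
      by (cases "i = j") auto
  qed
  then show ?thesis
    unfolding mat_powr_def mat_fun_spec[OF pos_def_hermitian[OF A]]
    by (intro mat_mult.tendsto tendsto_const)
qed

lemma powr_deriv_zero:
  fixes A :: "complex^'n^'n"
  assumes "pos_def A"
  shows "powr_deriv 0 A X = 0"
proof -
  \<comment> \<open>Positivity of the eigenvalues matters, because
    \<open>0 powr 0 = 0\<close>.\<close>
  have "dd (\<lambda>x. x powr 0) (\<lambda>x. 0 * x powr (0 - 1)) (spec_vals A i) (spec_vals A j) = 0" for i j
    using pos_def_spec_vals[OF assms, of i] pos_def_spec_vals[OF assms, of j] by (simp add: dd_def)
  moreover have "(\<chi> i j. 0) = (0 :: complex^'n^'n)"
    by (simp add: vec_eq_iff)
  ultimately show ?thesis
    by (simp add: powr_deriv_def mat_fun_deriv_def dop_def mat_mult.zero_left mat_mult.zero_right)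
qed

lemma powr_deriv_one:
  fixes A :: "complex^'n^'n"
  assumes "pos_def A"
  shows "powr_deriv 1 A X = X"
proof -
  have "dd (\<lambda>x. x powr 1) (\<lambda>x. 1 * x powr (1 - 1)) (spec_vals A i) (spec_vals A j) = 1" for i j
    using pos_def_spec_vals[OF assms, of i] pos_def_spec_vals[OF assms, of j] by (simp add: dd_def)
  moreover have "(\<chi> i j. M $ i $ j) = M" for M :: "complex^'n^'n"
    by (simp add: vec_eq_iff)
  ultimately show ?thesis
    using unitary_cancel(2)[OF spec(1) spec(1), OF pos_def_hermitian pos_def_hermitian, OF assms assms]
    by (simp add: powr_deriv_def mat_fun_deriv_def dop_def)
qed

section \<open>Derivatives of the divergences\<close>

definition sandwich :: "real \<Rightarrow> real \<Rightarrow> complex^'n^'n \<Rightarrow> complex^'n^'n \<Rightarrow> complex^'n^'n" where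
  "sandwich s r A B = mat_powr B s ** mat_powr A r ** mat_powr B s"

text \<open>Up to the factor \<open>z\<close>, the matrix against which the derivative of
  \<open>mat_powr B s\<close> is traced when \<open>trace (mat_powr (sandwich s r A B) z)\<close> is
  differentiated in \<open>B\<close>. The two summands come from the two outer factors of the
  sandwich.\<close>

definition sandwich_weight :: "real \<Rightarrow> real \<Rightarrow> real \<Rightarrow> complex^'n^'n \<Rightarrow> complex^'n^'n \<Rightarrow> complex^'n^'n" where
  "sandwich_weight z s r A B =
     mat_powr A r ** (mat_powr B s ** mat_powr (sandwich s r A B) (z - 1)) +
     mat_powr (sandwich s r A B) (z - 1) ** mat_powr B s ** mat_powr A r"

lemma D_alpha_z_sandwich:
  "D_alpha_z \<alpha> z A B = 1 / (\<alpha> - 1) *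
     ln (Re (trace (mat_powr (sandwich ((1 - \<alpha>) / (2 * z)) (\<alpha> / z) A B) z)))"
  by (simp add: D_alpha_z_def sandwich_def)

text \<open>A congruence of \<open>mat_powr A r\<close> by \<open>mat_powr B s\<close>, whose
  inverse is \<open>mat_powr B (- s)\<close>.\<close>

lemma pos_def_sandwich:
  assumes A: "pos_def A" and B: "pos_def B"
  shows "pos_def (sandwich s r A B)"
proof -
  have "cadj (mat_powr B s) = mat_powr B s"
    using pos_def_hermitian[OF pos_def_mat_powr[OF B]] by (simp add: hermitian_def)
  moreover have "mat_powr B (- s) ** mat_powr B s = mat 1"
    by (simp add: mat_powr_mult pos_def_hermitian mat_powr_zero B)
  ultimately show ?thesis
    using pos_def_cong_transform[OF pos_def_mat_powr[OF A], of "mat_powr B (- s)" "mat_powr B s" r]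
    by (simp add: sandwich_def)
qed

lemma sandwich_same:
  assumes "pos_def A"
  shows "sandwich s r A A = mat_powr A (2 * s + r)"
  by (simp add: sandwich_def mat_powr_mult pos_def_hermitian[OF assms] algebra_simps)

lemma has_vector_derivative_sandwich:
  assumes B: "(B has_vector_derivative B') (at t)" and pos: "\<And>u. pos_def (B u)"
  shows "((\<lambda>u. sandwich s r A (B u)) has_vector_derivative
     powr_deriv s (B t) B' ** mat_powr A r ** mat_powr (B t) s +
     mat_powr (B t) s ** mat_powr A r ** powr_deriv s (B t) B') (at t)"
proof -
  note P = has_vector_derivative_mat_powr[OF B pos, of s]
  have "((\<lambda>u. mat_powr (B u) s ** mat_powr A r) has_vector_derivative powr_deriv s (B t) B' ** mat_powr A r) (at t)"
    by (rule bounded_linear.has_vector_derivative[OF mat_mult.bounded_linear_left P])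
  from mat_mult.has_vector_derivative[OF this P] show ?thesis
    unfolding sandwich_def by (simp add: add.commute)
qed

lemma has_derivative_D_alpha_z:
  fixes B :: "real \<Rightarrow> complex^'n^'n"
  assumes A: "pos_def A" and B: "(B has_vector_derivative B') (at t)"
    and pos: "\<And>u. pos_def (B u)" and z: "z > 0"
    and s: "s = (1 - \<alpha>) / (2 * z)" and r: "r = \<alpha> / z"
  shows "((\<lambda>u. D_alpha_z \<alpha> z A (B u)) has_real_derivative
     1 / (\<alpha> - 1) * (z * Re (trace (sandwich_weight z s r A (B t) ** powr_deriv s (B t) B'))
       / Re (trace (mat_powr (sandwich s r A (B t)) z)))) (at t)"
proof -
  let ?M = "sandwich s r A (B t)" and ?P = "powr_deriv s (B t) B'"
  let ?M' = "?P ** mat_powr A r ** mat_powr (B t) s + mat_powr (B t) s ** mat_powr A r ** ?P"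
  let ?Q = "\<lambda>u. Re (trace (mat_powr (sandwich s r A (B u)) z))"
  note posM = pos_def_sandwich[OF A pos]
  have "(?Q has_vector_derivative Re (trace (powr_deriv z ?M ?M'))) (at t)"
    by (intro bounded_linear.has_vector_derivative[OF bounded_linear_Re_trace]
        has_vector_derivative_mat_powr has_vector_derivative_sandwich B pos posM)
  moreover have "trace (powr_deriv z ?M ?M') = z *\<^sub>R trace (sandwich_weight z s r A (B t) ** ?P)"
  proof -
    \<comment> \<open>Cyclicity of the trace moves the derivative of the left outer factor to the
      right end.\<close>
    have 1: "trace (mat_powr ?M (z - 1) ** ?P ** mat_powr A r ** mat_powr (B t) s) =
        trace (mat_powr A r ** mat_powr (B t) s ** mat_powr ?M (z - 1) ** ?P)"
      using trace_mul_sym[of "mat_powr ?M (z - 1) ** ?P" "mat_powr A r ** mat_powr (B t) s"]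
      by (simp only: matrix_mul_assoc)
    show ?thesis
      unfolding trace_powr_deriv[OF pos_def_hermitian[OF posM]]
      by (simp only: sandwich_weight_def mat_mult.add_left mat_mult.add_right trace_add matrix_mul_assoc 1)
  qed
  ultimately have Q: "(?Q has_real_derivative z * Re (trace (sandwich_weight z s r A (B t) ** ?P))) (at t)"
    by (simp add: has_real_derivative_iff_has_vector_derivative)
  have "?Q t > 0"
    by (intro trace_mat_powr_pos posM)
  from DERIV_cmult[OF DERIV_chain2[OF DERIV_ln_divide[OF this] Q], of "1 / (\<alpha> - 1)"]
  show ?thesis
    unfolding D_alpha_z_sandwich s[symmetric] r[symmetric] by simp
qed

text \<open>The derivative of \<open>sandwich_weight\<close> at \<open>B = A\<close> in direction
  \<open>Y\<close> when \<open>2 * s + r = 1 / z\<close>, in which case the sandwich is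
  \<open>mat_powr A (1 / z)\<close>. The arrangement of the terms is the one produced by the product
  rule.\<close>

definition weight_deriv :: "real \<Rightarrow> real \<Rightarrow> real \<Rightarrow> complex^'n^'n \<Rightarrow> complex^'n^'n \<Rightarrow> complex^'n^'n" where
  "weight_deriv z s r A Y =
    (let P = powr_deriv s A Y;
         Z = powr_deriv (z - 1) (mat_powr A (1 / z)) (P ** mat_powr A r ** mat_powr A s + mat_powr A s ** mat_powr A r ** P);
         W = mat_powr (mat_powr A (1 / z)) (z - 1)
     in mat_powr A r ** (mat_powr A s ** Z + P ** W) + (W ** P + Z ** mat_powr A s) ** mat_powr A r)"

lemma has_vector_derivative_sandwich_weight:
  assumes B: "(B has_vector_derivative Y) (at 0)" and pos: "\<And>u. pos_def (B u)" and A: "B 0 = A"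
    and sr: "2 * s + r = 1 / z"
  shows "((\<lambda>t. sandwich_weight z s r A (B t)) has_vector_derivative weight_deriv z s r A Y) (at 0)"
proof -
  have posA: "pos_def A"
    using pos[of 0] by (simp add: A)
  have M0: "sandwich s r A A = mat_powr A (1 / z)"
    by (simp add: sandwich_same posA sr)
  note P = has_vector_derivative_mat_powr[OF B pos, of s]
  note W = has_vector_derivative_mat_powr[OF has_vector_derivative_sandwich[OF B pos, of s r A] pos_def_sandwich[OF posA pos], of "z - 1"]
  note PW = bounded_linear.has_vector_derivative[OF mat_mult.bounded_linear_right mat_mult.has_vector_derivative[OF P W], of "mat_powr A r"]
  note WP = bounded_linear.has_vector_derivative[OF mat_mult.bounded_linear_left mat_mult.has_vector_derivative[OF W P], of "mat_powr A r"]
  from has_vector_derivative_add[OF PW WP] show ?thesis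
    unfolding sandwich_weight_def weight_deriv_def A M0 Let_def .
qed

text \<open>All factors are powers of \<open>A\<close>, and in each summand the exponents add up to
  \<open>r + s + (z - 1) / z = 1 - s\<close>.\<close>

lemma sandwich_weight_same:
  assumes A: "pos_def A" and sr: "2 * s + r = 1 / z" and z: "z > 0"
  shows "sandwich_weight z s r A A = 2 *\<^sub>R mat_powr A (1 - s)"
proof -
  have e: "1 / z * (z - 1) = 1 - 1 / z"
    using z by (simp add: field_simps)
  have r: "r = 1 / z - 2 * s"
    using sr by simp
  show ?thesis
    unfolding sandwich_weight_def sandwich_same[OF A] sr
    by (simp only: mat_powr_powr[OF pos_def_hermitian[OF A]] mat_powr_mult[OF pos_def_hermitian[OF A]] e)
       (simp add: r scaleR_2 algebra_simps)
qed

text \<open>\<open>Y\<close> is the derivative of the family along the line \<open>B\<close>, and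
  \<open>X t\<close> its derivative in the other direction at the point \<open>B t\<close>. As
  \<open>X t\<close> is traceless, \<open>2 *\<^sub>R mat_powr (B t) (1 - s)\<close> may be
  subtracted from the weight, which then vanishes at \<open>0\<close>.\<close>

lemma second_derivative_D_alpha_z:
  fixes B :: "real \<Rightarrow> complex^'n^'n"
  assumes B: "(B has_vector_derivative Y) (at 0)" and pos: "\<And>u. pos_def (B u)" and A: "B 0 = A"
    and tr: "trace A = 1" and X: "(X \<longlongrightarrow> X0) (at 0)" and trX: "\<And>t. trace (X t) = 0"
    and z: "z > 0" and sr: "2 * s + r = 1 / z"
  shows "((\<lambda>t. 1 / (\<alpha> - 1) * (z * Re (trace (sandwich_weight z s r A (B t) ** powr_deriv s (B t) (X t)))
       / Re (trace (mat_powr (sandwich s r A (B t)) z)))) has_real_derivative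
     z / (\<alpha> - 1) * Re (trace ((weight_deriv z s r A Y - 2 *\<^sub>R powr_deriv (1 - s) A Y) ** powr_deriv s A X0))) (at 0)"
proof -
  let ?Q = "\<lambda>t. Re (trace (mat_powr (sandwich s r A (B t)) z))"
  let ?E = "\<lambda>t. sandwich_weight z s r A (B t) - 2 *\<^sub>R mat_powr (B t) (1 - s)"
  let ?P = "\<lambda>t. powr_deriv s (B t) (X t)"
  let ?E' = "weight_deriv z s r A Y - 2 *\<^sub>R powr_deriv (1 - s) A Y"
  have posA: "pos_def A"
    using pos[of 0] by (simp add: A)
  have E: "(?E has_vector_derivative ?E') (at 0)"
    using has_vector_derivative_mat_powr[OF B pos, of "1 - s"]
    by (intro has_vector_derivative_diff has_vector_derivative_sandwich_weight[OF B pos A sr]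
        bounded_linear.has_vector_derivative[OF bounded_linear_scaleR_right]) (simp add: A)
  have E0: "?E 0 = 0"
    by (simp add: A sandwich_weight_same[OF posA sr z])
  have "(B \<longlongrightarrow> A) (at 0)"
    using has_vector_derivative_continuous[OF B] by (simp add: A continuous_within)
  then have P: "(?P \<longlongrightarrow> powr_deriv s A X0) (at 0)"
    unfolding powr_deriv_def
    by (intro tendsto_mat_fun_deriv[OF C2_pos_powr posA] X pos_def_hermitian pos)
  have "(?Q has_vector_derivative
      Re (trace (powr_deriv z (sandwich s r A (B 0)) (powr_deriv s (B 0) Y ** mat_powr A r ** mat_powr (B 0) s +
     mat_powr (B 0) s ** mat_powr A r ** powr_deriv s (B 0) Y)))) (at 0)"
    by (intro bounded_linear.has_vector_derivative[OF bounded_linear_Re_trace]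
        has_vector_derivative_mat_powr has_vector_derivative_sandwich B pos pos_def_sandwich posA)
  then have "(?Q \<longlongrightarrow> ?Q 0) (at 0)"
    using has_vector_derivative_continuous by (fastforce simp: continuous_within)
  moreover have "?Q 0 = 1"
    using z by (simp add: A sandwich_same[OF posA] sr mat_powr_powr[OF pos_def_hermitian[OF posA]]
        mat_powr_one[OF posA] tr)
  \<comment> \<open>The denominator joins the factor that enters through its limit, so it is never
    differentiated; it tends to the trace of \<open>A\<close>, which is \<open>1\<close>.\<close>
  ultimately have "((\<lambda>t. (z / (\<alpha> - 1) / ?Q t) *\<^sub>R ?P t) \<longlongrightarrow> (z / (\<alpha> - 1) / 1) *\<^sub>R powr_deriv s A X0) (at 0)"
    by (intro tendsto_scaleR tendsto_divide tendsto_const P) auto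
  from bounded_linear.has_vector_derivative[OF bounded_linear_Re_trace
      mat_mult.has_vector_derivative_vanishing[OF E E0 this]]
  have "((\<lambda>t. z / (\<alpha> - 1) / ?Q t * Re (trace (?E t ** ?P t))) has_real_derivative
      z / (\<alpha> - 1) * Re (trace (?E' ** powr_deriv s A X0))) (at 0)"
    by (simp add: has_real_derivative_iff_has_vector_derivative scaleR_mat_mult
        linear_cmul[OF bounded_linear.linear[OF bounded_linear_Re_trace]])
  moreover have "Re (trace (?E t ** ?P t)) = Re (trace (sandwich_weight z s r A (B t) ** ?P t))" for t
    unfolding mat_mult.diff_left trace_sub scaleR_mat_mult
    using trace_powr_powr_deriv[OF pos[of t], of s "X t"] trX[of t]
      linear_cmul[OF bounded_linear.linear[OF bounded_linear_Re_trace], of 2 "mat_powr (B t) (1 - s) ** ?P t"]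
    by simp
  ultimately show ?thesis
    by (simp add: mult.assoc)
qed

section \<open>Derivatives of the relative entropy\<close>

lemma has_vector_derivative_ln:
  assumes "(B has_vector_derivative B') (at t)" "\<And>u. pos_def (B u)"
  shows "((\<lambda>u. mat_ln (B u)) has_vector_derivative ln_deriv (B t) B') (at t)"
  unfolding mat_ln_def ln_deriv_def
  by (intro has_vector_derivative_mat_fun[OF C2_pos_ln assms(1)] pos_def_hermitian assms(2))

lemma has_derivative_rel_entropy:
  fixes B :: "real \<Rightarrow> complex^'n^'n"
  assumes B: "(B has_vector_derivative B') (at t)" and pos: "\<And>u. pos_def (B u)"
  shows "((\<lambda>u. rel_entropy A (B u)) has_real_derivative - Re (trace (A ** ln_deriv (B t) B'))) (at t)"
proof -
  have "((\<lambda>u. mat_ln A - mat_ln (B u)) has_vector_derivative 0 - ln_deriv (B t) B') (at t)"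
    by (intro has_vector_derivative_diff has_vector_derivative_const has_vector_derivative_ln B pos)
  from bounded_linear.has_vector_derivative[OF bounded_linear_Re_trace
      bounded_linear.has_vector_derivative[OF mat_mult.bounded_linear_right this, of A]]
  show ?thesis
    by (simp add: rel_entropy_def has_real_derivative_iff_has_vector_derivative mat_mult.minus_right
        linear_neg[OF bounded_linear.linear[OF bounded_linear_Re_trace]])
qed

text \<open>Since \<open>trace (B t ** ln_deriv (B t) (X t)) = trace (X t) = 0\<close>, the matrix
  \<open>- A\<close> may be replaced by \<open>B t - A\<close>, which vanishes at
  \<open>0\<close>.\<close>

lemma second_derivative_rel_entropy:
  fixes B :: "real \<Rightarrow> complex^'n^'n"
  assumes B: "(B has_vector_derivative Y) (at 0)" and pos: "\<And>u. pos_def (B u)" and A: "B 0 = A"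
    and X: "(X \<longlongrightarrow> X0) (at 0)" and trX: "\<And>t. trace (X t) = 0"
  shows "((\<lambda>t. - Re (trace (A ** ln_deriv (B t) (X t)))) has_real_derivative
     Re (trace (Y ** ln_deriv A X0))) (at 0)"
proof -
  have posA: "pos_def A"
    using pos[of 0] by (simp add: A)
  have E: "((\<lambda>t. B t - A) has_vector_derivative Y - 0) (at 0)"
    by (intro has_vector_derivative_diff has_vector_derivative_const B)
  have "(B \<longlongrightarrow> A) (at 0)"
    using has_vector_derivative_continuous[OF B] by (simp add: A continuous_within)
  then have P: "((\<lambda>t. ln_deriv (B t) (X t)) \<longlongrightarrow> ln_deriv A X0) (at 0)"
    unfolding ln_deriv_def
    by (intro tendsto_mat_fun_deriv[OF C2_pos_ln posA] X pos_def_hermitian pos)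
  from bounded_linear.has_vector_derivative[OF bounded_linear_Re_trace
      mat_mult.has_vector_derivative_vanishing[OF E _ P]]
  have "((\<lambda>t. Re (trace ((B t - A) ** ln_deriv (B t) (X t)))) has_real_derivative
      Re (trace (Y ** ln_deriv A X0))) (at 0)"
    by (simp add: has_real_derivative_iff_has_vector_derivative A)
  then show ?thesis
    by (simp add: mat_mult.diff_left trace_sub trace_ln_deriv[OF pos] trX)
qed

section \<open>Information matrices of a family of states\<close>

lemma twice_differentiableE:
  assumes "twice_differentiable f"
  obtains f' where "\<And>x. (f has_derivative blinfun_apply (f' x)) (at x)" "\<And>x. isCont f' x"
  using assms unfolding twice_differentiable_def by (metis differentiable_imp_continuous_within)

lemma partial_deriv_partial_deriv:
  "partial_deriv i (partial_deriv j f) 0 =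
     deriv (\<lambda>t. deriv (\<lambda>u. f (t *\<^sub>R axis i 1 + u *\<^sub>R axis j 1)) 0) 0"
  by (simp add: partial_deriv_def)

context
  fixes \<rho> :: "real^'l::finite \<Rightarrow> complex^'n::finite^'n" and \<rho>' and \<theta> :: "real^'l"
  assumes \<rho>': "\<And>x. (\<rho> has_derivative blinfun_apply (\<rho>' x)) (at x)"
    and cont: "\<And>x. isCont \<rho>' x"
    and state: "\<And>x. pos_def_state (\<rho> x)"
begin

lemma state_pos_def: "pos_def (\<rho> x)" and state_trace: "trace (\<rho> x) = 1"
  using state[of x] by (auto simp: pos_def_state_def)

lemma line_deriv: "((\<lambda>u. \<rho> (x + u *\<^sub>R v)) has_vector_derivative \<rho>' x v) (at 0)"
proof -
  have "((\<lambda>u. x + u *\<^sub>R v) has_derivative (\<lambda>u. u *\<^sub>R v)) (at (0::real))"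
    by (auto intro!: derivative_eq_intros)
  from has_derivative_compose[OF this, of \<rho> "blinfun_apply (\<rho>' x)"] \<rho>'[of x]
  show ?thesis
    by (simp add: has_vector_derivative_def blinfun.scaleR_right)
qed

lemma line_deriv_tendsto: "((\<lambda>t. \<rho>' (\<theta> + t *\<^sub>R w) v) \<longlongrightarrow> \<rho>' \<theta> v) (at (0::real))"
proof -
  have "((\<lambda>t. \<theta> + t *\<^sub>R w) \<longlongrightarrow> \<theta> + 0 *\<^sub>R w) (at (0::real))"
    by (intro tendsto_intros)
  then have "((\<lambda>t. \<rho>' (\<theta> + t *\<^sub>R w)) \<longlongrightarrow> \<rho>' \<theta>) (at (0::real))"
    using isCont_tendsto_compose[OF cont[of \<theta>]] by simp
  then show ?thesis
    by (intro tendsto_intros)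
qed

text \<open>The trace is constant along every line in the parameter space.\<close>

lemma trace_deriv_zero: "trace (\<rho>' x v) = 0"
proof -
  have "bounded_linear (trace :: complex^'n^'n \<Rightarrow> complex)"
    unfolding trace_def
    by (intro bounded_linear_sum bounded_linear_compose[OF bounded_linear_vec_nth] bounded_linear_vec_nth)
  from bounded_linear.has_vector_derivative[OF this line_deriv[of x v]]
  have "((\<lambda>u. 1 :: complex) has_vector_derivative trace (\<rho>' x v)) (at 0)"
    by (simp add: state_trace)
  then show ?thesis
    using vector_derivative_unique_at has_vector_derivative_const by blast
qed

lemma I_KM_eq: "I_KM \<rho> \<theta> $ i $ j = Re (trace (\<rho>' \<theta> (axis i 1) ** ln_deriv (\<rho> \<theta>) (\<rho>' \<theta> (axis j 1))))"
proof -
  let ?B = "\<lambda>t. \<rho> (\<theta> + t *\<^sub>R axis i 1)" and ?X = "\<lambda>t. \<rho>' (\<theta> + t *\<^sub>R axis i 1) (axis j 1)"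
  have "deriv (\<lambda>u. rel_entropy (\<rho> \<theta>) (\<rho> (\<theta> + (t *\<^sub>R axis i 1 + u *\<^sub>R axis j 1)))) 0 =
      - Re (trace (\<rho> \<theta> ** ln_deriv (?B t) (?X t)))" for t
    using DERIV_imp_deriv[OF has_derivative_rel_entropy[OF line_deriv[of "\<theta> + t *\<^sub>R axis i 1" "axis j 1"] state_pos_def, of "\<rho> \<theta>"]]
    by (simp add: add.assoc)
  then have "I_KM \<rho> \<theta> $ i $ j = deriv (\<lambda>t. - Re (trace (\<rho> \<theta> ** ln_deriv (?B t) (?X t)))) 0"
    by (simp add: I_KM_def partial_deriv_partial_deriv)
  also have "\<dots> = Re (trace (\<rho>' \<theta> (axis i 1) ** ln_deriv (\<rho> \<theta>) (\<rho>' \<theta> (axis j 1))))"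
    by (intro DERIV_imp_deriv second_derivative_rel_entropy line_deriv state_pos_def line_deriv_tendsto trace_deriv_zero) simp
  finally show ?thesis .
qed

lemma I_alpha_z_eq:
  assumes z: "z > 0" and s: "s = (1 - \<alpha>) / (2 * z)" and r: "r = \<alpha> / z"
  shows "I_alpha_z \<alpha> z \<rho> \<theta> $ i $ j = 1 / \<alpha> * (z / (\<alpha> - 1) *
    Re (trace ((weight_deriv z s r (\<rho> \<theta>) (\<rho>' \<theta> (axis i 1)) - 2 *\<^sub>R powr_deriv (1 - s) (\<rho> \<theta>) (\<rho>' \<theta> (axis i 1)))
       ** powr_deriv s (\<rho> \<theta>) (\<rho>' \<theta> (axis j 1)))))" (is "_ = 1 / \<alpha> * ?D")
proof -
  let ?B = "\<lambda>t. \<rho> (\<theta> + t *\<^sub>R axis i 1)" and ?X = "\<lambda>t. \<rho>' (\<theta> + t *\<^sub>R axis i 1) (axis j 1)"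
  let ?G = "\<lambda>t. 1 / (\<alpha> - 1) * (z * Re (trace (sandwich_weight z s r (\<rho> \<theta>) (?B t) ** powr_deriv s (?B t) (?X t)))
       / Re (trace (mat_powr (sandwich s r (\<rho> \<theta>) (?B t)) z)))"
  have sr: "2 * s + r = 1 / z"
    using z by (simp add: s r field_simps)
  have "deriv (\<lambda>u. D_alpha_z \<alpha> z (\<rho> \<theta>) (\<rho> (\<theta> + (t *\<^sub>R axis i 1 + u *\<^sub>R axis j 1)))) 0 = ?G t" for t
    using DERIV_imp_deriv[OF has_derivative_D_alpha_z[OF state_pos_def line_deriv[of "\<theta> + t *\<^sub>R axis i 1" "axis j 1"] state_pos_def z s r, of \<theta>]]
    by (simp add: add.assoc)
  then have "I_alpha_z \<alpha> z \<rho> \<theta> $ i $ j = 1 / \<alpha> * deriv ?G 0"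
    by (simp only: I_alpha_z_def partial_deriv_partial_deriv vec_lambda_beta)
  also have "deriv ?G 0 = ?D"
    by (intro DERIV_imp_deriv second_derivative_D_alpha_z line_deriv state_pos_def state_trace line_deriv_tendsto trace_deriv_zero z sr) simp
  finally show ?thesis .
qed

lemma I_alpha_z_tendsto:
  assumes z: "z > 0"
  shows "((\<lambda>\<alpha>. I_alpha_z \<alpha> z \<rho> \<theta>) \<longlongrightarrow> I_KM \<rho> \<theta>) (at 1)"
proof (intro vec_tendstoI)
  fix i j
  let ?A = "\<rho> \<theta>" and ?Y = "\<rho>' \<theta> (axis i 1)" and ?X = "\<rho>' \<theta> (axis j 1)"
  let ?s = "\<lambda>\<alpha>. (1 - \<alpha>) / (2 * z)" and ?r = "\<lambda>\<alpha>::real. \<alpha> / z"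
  let ?E = "\<lambda>\<alpha>. weight_deriv z (?s \<alpha>) (?r \<alpha>) ?A ?Y - 2 *\<^sub>R powr_deriv (1 - ?s \<alpha>) ?A ?Y"
  \<comment> \<open>These limits are punctured, so that they compose with the limits
    \<open>at 0\<close>, \<open>at 1\<close> and \<open>at (1 / z)\<close> in the exponents.\<close>
  have s: "filterlim ?s (at 0) (at 1)"
    using z by (auto simp: filterlim_at eventually_at_filter intro!: tendsto_eq_intros)
  have s1: "filterlim (\<lambda>\<alpha>. 1 - ?s \<alpha>) (at 1) (at 1)"
    using z by (auto simp: filterlim_at eventually_at_filter intro!: tendsto_eq_intros)
  have r: "filterlim ?r (at (1 / z)) (at 1)"
    using z by (auto simp: filterlim_at eventually_at_filter intro!: tendsto_eq_intros)
  note lim_s = filterlim_compose[OF tendsto_mat_powr_param[OF state_pos_def, of \<theta> 0] s]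
  note lim_r = filterlim_compose[OF tendsto_mat_powr_param[OF state_pos_def, of \<theta> "1 / z"] r]
  \<comment> \<open>The limit is zero in every direction; writing it as
    \<open>powr_deriv 0 ?A 0\<close> gives the limit of \<open>weight_deriv\<close> the form of a
    \<open>weight_deriv\<close> in direction \<open>0\<close>.\<close>
  have lim_P: "((\<lambda>\<alpha>. powr_deriv (?s \<alpha>) ?A ?Y) \<longlongrightarrow> powr_deriv 0 ?A 0) (at 1)"
    using filterlim_compose[OF tendsto_powr_deriv_param[OF state_pos_def, of \<theta> ?Y 0] s]
    by (simp add: powr_deriv_zero state_pos_def)
  have lim_1: "((\<lambda>\<alpha>. powr_deriv (1 - ?s \<alpha>) ?A ?Y) \<longlongrightarrow> ?Y) (at 1)"
    using filterlim_compose[OF tendsto_powr_deriv_param[OF state_pos_def, of \<theta> ?Y 1] s1]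
    by (simp add: powr_deriv_one state_pos_def)
  have "((\<lambda>\<alpha>. weight_deriv z (?s \<alpha>) (?r \<alpha>) ?A ?Y) \<longlongrightarrow> weight_deriv z 0 (1 / z) ?A 0) (at 1)"
    unfolding weight_deriv_def Let_def
    by (intro tendsto_add mat_mult.tendsto tendsto_const
        bounded_linear.tendsto[OF bounded_linear_powr_deriv] lim_s lim_r lim_P)
  moreover have "weight_deriv z 0 (1 / z) ?A 0 = 0"
    by (simp add: weight_deriv_def Let_def powr_deriv_zero state_pos_def mat_mult.zero_left mat_mult.zero_right
        linear_0[OF bounded_linear.linear[OF bounded_linear_powr_deriv]])
  ultimately have E: "(?E \<longlongrightarrow> 0 - 2 *\<^sub>R ?Y) (at 1)"
    by (intro tendsto_diff tendsto_scaleR tendsto_const lim_1) simp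
  have P: "((\<lambda>\<alpha>. (1 / ?s \<alpha>) *\<^sub>R powr_deriv (?s \<alpha>) ?A ?X) \<longlongrightarrow> ln_deriv ?A ?X) (at 1)"
    by (rule filterlim_compose[OF tendsto_powr_deriv_ln[OF state_pos_def] s])
  \<comment> \<open>For \<open>s = (1 - \<alpha>) / (2 * z)\<close> the prefactor
    \<open>z / (\<alpha> - 1)\<close> is \<open>- 1 / (2 * s)\<close>. Its part \<open>1 / s\<close>
    goes to the power derivative, which then tends to \<open>ln_deriv\<close>.\<close>
  have "((\<lambda>\<alpha>. 1 / \<alpha> * (- 1 / 2 * Re (trace (?E \<alpha> ** ((1 / ?s \<alpha>) *\<^sub>R powr_deriv (?s \<alpha>) ?A ?X)))))
      \<longlongrightarrow> 1 / 1 * (- 1 / 2 * Re (trace ((0 - 2 *\<^sub>R ?Y) ** ln_deriv ?A ?X)))) (at 1)"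
    by (intro tendsto_mult tendsto_divide tendsto_const tendsto_ident_at
        bounded_linear.tendsto[OF bounded_linear_Re_trace] mat_mult.tendsto E P) simp
  also have "1 / 1 * (- 1 / 2 * Re (trace ((0 - 2 *\<^sub>R ?Y) ** ln_deriv ?A ?X))) = I_KM \<rho> \<theta> $ i $ j"
    by (simp add: I_KM_eq mat_mult.minus_left scaleR_mat_mult
        linear_cmul[OF bounded_linear.linear[OF bounded_linear_Re_trace]]
        linear_neg[OF bounded_linear.linear[OF bounded_linear_Re_trace]])
  finally show "((\<lambda>\<alpha>. I_alpha_z \<alpha> z \<rho> \<theta> $ i $ j) \<longlongrightarrow> I_KM \<rho> \<theta> $ i $ j) (at 1)"
  proof (rule Lim_transform_eventually)
    have "- 1 / 2 * (1 / ?s \<alpha> * T) = z / (\<alpha> - 1) * T" if "\<alpha> \<noteq> 1" for \<alpha> T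
      using z that by (simp add: divide_simps) (simp add: algebra_simps)
    then show "\<forall>\<^sub>F \<alpha> in at 1. 1 / \<alpha> * (- 1 / 2 * Re (trace (?E \<alpha> ** ((1 / ?s \<alpha>) *\<^sub>R powr_deriv (?s \<alpha>) ?A ?X))))
        = I_alpha_z \<alpha> z \<rho> \<theta> $ i $ j"
      unfolding I_alpha_z_eq[OF z refl refl]
      by (simp only: eventually_at_filter scaleR_mat_mult real_scaleR_def
          linear_cmul[OF bounded_linear.linear[OF bounded_linear_Re_trace]]) simp
  qed
qed

end

section \<open>The scalar limit\<close>

text \<open>The prefactor is \<open>1 / \<alpha>\<close> divided by
  \<open>(1 - \<alpha>) / z\<close>. This divisor turns the first numerator into a difference
  quotient with limit \<open>ln x - ln y\<close>, while the second fraction tends to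
  \<open>1\<close>.\<close>

lemma zeta_alpha_z_tendsto:
  fixes x y z :: real
  assumes pos: "0 < x" "0 < y" "0 < z" and neq: "x \<noteq> y"
  shows "((\<lambda>\<alpha>. zeta_alpha_z \<alpha> z x y) \<longlongrightarrow> (ln x - ln y) / (x - y)) (at 1)"
proof -
  have s: "filterlim (\<lambda>\<alpha>. (1 - \<alpha>) / z) (at 0) (at 1)"
    using pos by (auto simp: filterlim_at eventually_at_filter intro!: tendsto_eq_intros)
  have xy: "x powr (1 / z) - y powr (1 / z) \<noteq> 0"
  proof
    assume "x powr (1 / z) - y powr (1 / z) = 0"
    then have "(x powr (1 / z)) powr z = (y powr (1 / z)) powr z"
      by simp
    then show False
      using pos neq by (simp add: powr_powr)
  qed
  have "((\<lambda>\<alpha>. 1 / \<alpha> * (((x powr ((1 - \<alpha>) / z) - y powr ((1 - \<alpha>) / z)) / ((1 - \<alpha>) / z)) / (x - y)) *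
      ((x powr (\<alpha> / z) - y powr (\<alpha> / z)) / (x powr (1 / z) - y powr (1 / z))))
      \<longlongrightarrow> 1 / 1 * ((ln x - ln y) / (x - y)) * ((x powr (1 / z) - y powr (1 / z)) / (x powr (1 / z) - y powr (1 / z)))) (at 1)"
    using pos neq xy
    by (intro tendsto_mult tendsto_divide tendsto_const tendsto_ident_at tendsto_diff tendsto_powr
        filterlim_compose[OF powr_diff_quotient_tendsto s]) auto
  then show ?thesis
    using xy by (simp add: zeta_alpha_z_def mult.commute mult.left_commute)
qed

theorem proposition16:
  shows "(\<forall>x y z :: real. 0 < x \<longrightarrow> 0 < y \<longrightarrow> 0 < z \<longrightarrow> x \<noteq> y \<longrightarrow>
            ((\<lambda>\<alpha>. zeta_alpha_z \<alpha> z x y) \<longlongrightarrow> (ln x - ln y) / (x - y)) (at 1))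
       \<and> (\<forall>\<rho> :: real^'l::finite \<Rightarrow> complex^'n::finite^'n.
            twice_differentiable \<rho> \<longrightarrow> (\<forall>\<theta>. pos_def_state (\<rho> \<theta>)) \<longrightarrow>
            (\<forall>z>0. \<forall>\<theta>. ((\<lambda>\<alpha>. I_alpha_z \<alpha> z \<rho> \<theta>) \<longlongrightarrow> I_KM \<rho> \<theta>) (at 1)))"
proof (intro conjI allI impI)
  show "((\<lambda>\<alpha>. zeta_alpha_z \<alpha> z x y) \<longlongrightarrow> (ln x - ln y) / (x - y)) (at 1)"
    if "0 < x" "0 < y" "0 < z" "x \<noteq> y" for x y z :: real
    using that by (rule zeta_alpha_z_tendsto)
next
  fix \<rho> :: "real^'l::finite \<Rightarrow> complex^'n::finite^'n" and z :: real and \<theta>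
  assume "twice_differentiable \<rho>" and state: "\<forall>\<theta>. pos_def_state (\<rho> \<theta>)" and z: "0 < z"
  then obtain \<rho>' where \<rho>': "\<And>x. (\<rho> has_derivative blinfun_apply (\<rho>' x)) (at x)" "\<And>x. isCont \<rho>' x"
    by - (erule twice_differentiableE, rule that; blast)
  show "((\<lambda>\<alpha>. I_alpha_z \<alpha> z \<rho> \<theta>) \<longlongrightarrow> I_KM \<rho> \<theta>) (at 1)"
    by (rule I_alpha_z_tendsto[OF \<rho>' _ z]) (use state in blast)
qed

end
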